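(* Let $(M,L)$ be a Finsler manifold with Finsler metric $g$ on $\pi^{-1}(TM)$ and Cartan connection $\nabla$. A $\pi$-vector field $\overline{X}$ is $\overline{d}$-closed if and only if the operator $A_{\overline{X}}:\overline{Y}\mapsto \nabla_{\beta\overline{Y}}\overline{X}$ is self-adjoint with respect to $g$, i.e. $g(A_{\overline{X}}\overline{Y},\overline{Z})=g(\overline{Y},A_{\overline{X}}\overline{Z})$ for all $\pi$-vector fields $\overline{Y},\overline{Z}$.
   Context: All objects are $C^\infty$. $M$ is an $n$-dimensional manifold, $\mathcal{T}M$ is the bundle of nonzero tangent vectors, $\pi:\mathcal{T}M\to M$ the projection, and $\pi^{-1}(TM)\to\mathcal{T}M$ the pullback of $TM$ by $\pi$, with fibre $\{u\}\times T_{\pi(u)}M$ at $u$. Its sections are called $\pi$-vector fields; tensor fields (forms) on $\pi^{-1}(TM)$ are called $\pi$-tensor fields ($\pi$-forms). A Finsler structure $L$ on $M$ is positive and smooth on $\mathcal{T}M$, positively homogeneous of degree 1 on fibres, and the fibrewise Hessian $g$ of $\frac12L^2$, which is a metric on $\pi^{-1}(TM)$ called the Finsler metric, is positive definite. The fundamental $\pi$-vector field is $\overline{\eta}(u)=(u,u)$. Let $\rho:T(\mathcal{T}M)\to\pi^{-1}(TM)$, $\rho(X)=(u,d\pi(X))$ for $X\in T_u(\mathcal{T}M)$, and $\gamma:\pi^{-1}(TM)\to T(\mathcal{T}M)$, $\gamma(u,v)=\frac{d}{dt}\big|_{t=0}(u+tv)$ (vertical lift). For a linear connection $\nabla$ in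 $\pi^{-1}(TM)$, its connection map is $K(X)=\nabla_X\overline{\eta}$; $\nabla$ is regular if $T(\mathcal{T}M)=V(\mathcal{T}M)\oplus H(\mathcal{T}M)$, where $V(\mathcal TM)=\ker\rho$ and $H(\mathcal TM)=\ker K$. For regular $\nabla$ set $\beta=(\rho|_{H(\mathcal{T}M)})^{-1}$ (horizontal lift). The torsion is $\mathbf{T}(X,Y)=\nabla_X\rho Y-\nabla_Y\rho X-\rho[X,Y]$, with $Q(\overline{X},\overline{Y})=\mathbf{T}(\beta\overline{X},\beta\overline{Y})$ and $T(\overline{X},\overline{Y})=\mathbf{T}(\gamma\overline{X},\beta\overline{Y})$. The Cartan connection of $(M,L)$ is the unique regular connection $\nabla$ in $\pi^{-1}(TM)$ with $\nabla g=0$, $Q=0$ and $g(T(\overline{X},\overline{Y}),\overline{Z})=g(T(\overline{X},\overline{Z}),\overline{Y})$; $\beta$ and $K$ below refer to it. The $\pi$-exterior derivative $\overline{d}$: for a function $f$ on $\mathcal{T}M$, $(\overline{d}f)(\overline{X})=\beta\overline{X}\cdot f$; for a $\pi$-form $\omega$ of order 1, $$(\overline{d}\omega)(\overline{X},\overline{Y})=\beta\overline{X}\cdot\omega(\overline{Y})-\beta\overline{Y}\cdot\omega(\overline{X})-\omega(\rho[\beta\overline{X},\beta\overline{Y}]).$$ A $\pi$-form $\omega$ is $\overline{d}$-closed if $\overline{d}\omega=0$. A $\pi$-vector field $\overline{X}$ is $\overline{d}$-closed if the associated 1-$\pi$-form $i_{\overline{X}}g=g(\overline{X},\cdot)$ is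 $\overline{d}$-closed. *)

theory Defs
  imports "HOL-Analysis.Analysis"
begin

section \<open>Smooth maps between open subsets of normed spaces\<close>

text \<open>
  \<open>Ck_on k S f\<close> is meant for open \<open>S\<close>: all iterated directional derivatives of \<open>f\<close> of
  order at most \<open>k\<close> exist and are continuous on \<open>S\<close>.
\<close>

primrec Ck_on :: "nat \<Rightarrow> 'a::real_normed_vector set \<Rightarrow> ('a \<Rightarrow> 'b::real_normed_vector) \<Rightarrow> bool" where
  "Ck_on 0 S f \<longleftrightarrow> continuous_on S f"
| "Ck_on (Suc k) S f \<longleftrightarrow>
     (\<forall>x\<in>S. f differentiable (at x)) \<and> (\<forall>v. Ck_on k S (\<lambda>x. frechet_derivative f (at x) v))"

definition smooth_on :: "'a::real_normed_vector set \<Rightarrow> ('a \<Rightarrow> 'b::real_normed_vector) \<Rightarrow> bool" where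
  "smooth_on S f \<longleftrightarrow> (\<forall>k. Ck_on k S f)"


section \<open>Smooth manifolds\<close>

text \<open>
  A chart is a domain together with a map that only matters on this domain. The underlying set
  and the topology of a manifold are read off from its atlas, which need not be maximal. The
  dimension of the manifold is the dimension of the model space \<open>'e\<close>.
\<close>

type_synonym ('m, 'e) chart = "'m set \<times> ('m \<Rightarrow> 'e)"
type_synonym ('m, 'e) atlas = "('m, 'e) chart set"

definition points :: "('m, 'e) atlas \<Rightarrow> 'm set" where
  "points A = (\<Union>(U, \<phi>)\<in>A. U)"

definition manifold_topology :: "('m, 'e::euclidean_space) atlas \<Rightarrow> 'm topology" where
  "manifold_topology A =
     topology (\<lambda>W. W \<subseteq> points A \<and> (\<forall>(U, \<phi>)\<in>A. open (\<phi> ` (U \<inter> W))))"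

lemma openin_manifold_topology:
  assumes "\<forall>(U, \<phi>)\<in>A. inj_on \<phi> U \<and> open (\<phi> ` U)"
  shows "openin (manifold_topology A) W \<longleftrightarrow>
           W \<subseteq> points A \<and> (\<forall>(U, \<phi>)\<in>A. open (\<phi> ` (U \<inter> W)))"
proof -
  have "istopology (\<lambda>W. W \<subseteq> points A \<and> (\<forall>(U, \<phi>)\<in>A. open (\<phi> ` (U \<inter> W))))"
    unfolding istopology_def
  proof (intro conjI allI impI)
    fix S T
    assume S: "S \<subseteq> points A \<and> (\<forall>(U, \<phi>)\<in>A. open (\<phi> ` (U \<inter> S)))"
      and T: "T \<subseteq> points A \<and> (\<forall>(U, \<phi>)\<in>A. open (\<phi> ` (U \<inter> T)))"
    then show "S \<inter> T \<subseteq> points A" by blast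
    show "\<forall>(U, \<phi>)\<in>A. open (\<phi> ` (U \<inter> (S \<inter> T)))"
    proof safe
      fix U \<phi> assume "(U, \<phi>) \<in> A"
      then have "inj_on \<phi> U" "open (\<phi> ` (U \<inter> S))" "open (\<phi> ` (U \<inter> T))"
        using assms S T by auto
      moreover have "\<phi> ` (U \<inter> (S \<inter> T)) = \<phi> ` (U \<inter> S) \<inter> \<phi> ` (U \<inter> T)"
        using \<open>inj_on \<phi> U\<close> by (auto simp: inj_on_def)
      ultimately show "open (\<phi> ` (U \<inter> (S \<inter> T)))" by (simp add: open_Int)
    qed
  next
    fix \<K> assume K: "\<forall>K\<in>\<K>. K \<subseteq> points A \<and> (\<forall>(U, \<phi>)\<in>A. open (\<phi> ` (U \<inter> K)))"
    then show "\<Union>\<K> \<subseteq> points A" by blast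
    show "\<forall>(U, \<phi>)\<in>A. open (\<phi> ` (U \<inter> \<Union>\<K>))"
    proof safe
      fix U \<phi> assume "(U, \<phi>) \<in> A"
      then have "open (\<Union>K\<in>\<K>. \<phi> ` (U \<inter> K))" using K by (intro open_UN ballI) fast
      moreover have "\<phi> ` (U \<inter> \<Union>\<K>) = (\<Union>K\<in>\<K>. \<phi> ` (U \<inter> K))" by blast
      ultimately show "open (\<phi> ` (U \<inter> \<Union>\<K>))" by simp
    qed
  qed
  then show ?thesis
    unfolding manifold_topology_def by (simp add: topology_inverse')
qed

definition smooth_manifold :: "('m, 'e::euclidean_space) atlas \<Rightarrow> bool" where
  "smooth_manifold A \<longleftrightarrow>
     (\<forall>(U, \<phi>)\<in>A. inj_on \<phi> U \<and> open (\<phi> ` U)) \<and>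
     (\<forall>(U, \<phi>)\<in>A. \<forall>(V, \<psi>)\<in>A.
        open (\<phi> ` (U \<inter> V)) \<and> smooth_on (\<phi> ` (U \<inter> V)) (\<lambda>x. \<psi> (inv_into U \<phi> x))) \<and>
     Hausdorff_space (manifold_topology A) \<and>
     second_countable (manifold_topology A)"

text \<open>The model space as a manifold; for \<open>'e = real\<close> it is the target of smooth functions.\<close>

definition euclid :: "('e, 'e::euclidean_space) atlas" where
  "euclid = {(UNIV, \<lambda>x. x)}"

text \<open>Smoothness on a neighbourhood of the point \<open>p\<close>, expressed in charts.\<close>

definition smooth_at ::
    "('m, 'e::euclidean_space) atlas \<Rightarrow> ('n, 'f::euclidean_space) atlas \<Rightarrow> ('m \<Rightarrow> 'n) \<Rightarrow> 'm \<Rightarrow> bool" where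
  "smooth_at A B f p \<longleftrightarrow> p \<in> points A \<and> f p \<in> points B \<and>
     (\<forall>(U, \<phi>)\<in>A. \<forall>(V, \<psi>)\<in>B. p \<in> U \<and> f p \<in> V \<longrightarrow>
        (\<exists>S. open S \<and> \<phi> p \<in> S \<and> S \<subseteq> \<phi> ` U \<and> (\<forall>x\<in>S. f (inv_into U \<phi> x) \<in> V) \<and>
             smooth_on S (\<lambda>x. \<psi> (f (inv_into U \<phi> x)))))"

definition smooth_map ::
    "('m, 'e::euclidean_space) atlas \<Rightarrow> ('n, 'f::euclidean_space) atlas \<Rightarrow> ('m \<Rightarrow> 'n) \<Rightarrow> bool" where
  "smooth_map A B f \<longleftrightarrow> (\<forall>p\<in>points A. smooth_at A B f p)"


section \<open>Tangent vectors and the tangent bundle\<close>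

text \<open>
  A tangent vector at \<open>p\<close> is the operator \<open>f \<mapsto> (f \<circ> c)'(0)\<close> for a smooth curve \<open>c\<close> with
  \<open>c 0 = p\<close>. It acts on all real functions that are smooth near \<open>p\<close>, and is set to \<open>0\<close> on other
  functions, so that equality of tangent vectors at \<open>p\<close> is equality of functions. The vector
  space operations are pointwise.
\<close>

type_synonym 'm tvec = "('m \<Rightarrow> real) \<Rightarrow> real"
type_synonym 'm tpoint = "'m \<times> 'm tvec"

abbreviation tzero :: "'m tvec" where
  "tzero \<equiv> (\<lambda>f. 0)"

abbreviation tadd :: "'m tvec \<Rightarrow> 'm tvec \<Rightarrow> 'm tvec" where
  "tadd v w \<equiv> (\<lambda>f. v f + w f)"

abbreviation tdiff :: "'m tvec \<Rightarrow> 'm tvec \<Rightarrow> 'm tvec" where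
  "tdiff v w \<equiv> (\<lambda>f. v f - w f)"

abbreviation tscale :: "real \<Rightarrow> 'm tvec \<Rightarrow> 'm tvec" where
  "tscale a v \<equiv> (\<lambda>f. a * v f)"

definition velocity :: "('m, 'e::euclidean_space) atlas \<Rightarrow> (real \<Rightarrow> 'm) \<Rightarrow> 'm tvec" where
  "velocity A c = (\<lambda>f. if smooth_at A euclid f (c 0) then deriv (\<lambda>t. f (c t)) 0 else 0)"

definition tangent_space :: "('m, 'e::euclidean_space) atlas \<Rightarrow> 'm \<Rightarrow> 'm tvec set" where
  "tangent_space A p = {velocity A c | c. smooth_at euclid A c 0 \<and> c 0 = p}"

definition differential ::
    "('n, 'f::euclidean_space) atlas \<Rightarrow> ('m \<Rightarrow> 'n) \<Rightarrow> 'm \<Rightarrow> 'm tvec \<Rightarrow> 'n tvec" where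
  "differential B F p \<xi> = (\<lambda>f. if smooth_at B euclid f (F p) then \<xi> (\<lambda>q. f (F q)) else 0)"

text \<open>
  The charts of the tangent bundle: a chart \<open>\<phi>\<close> of the base induces
  \<open>(p, v) \<mapsto> (\<phi> p, (v \<phi>\<^sup>1, \<dots>, v \<phi>\<^sup>n))\<close>, where \<open>\<phi>\<^sup>i\<close> are the components of \<open>\<phi>\<close>.
\<close>

definition tangent_chart ::
    "('m, 'e::euclidean_space) atlas \<Rightarrow> ('m, 'e) chart \<Rightarrow> ('m tpoint, 'e \<times> 'e) chart" where
  "tangent_chart A = (\<lambda>(U, \<phi>).
     ({(p, v). p \<in> U \<and> v \<in> tangent_space A p},
      \<lambda>(p, v). (\<phi> p, \<Sum>b\<in>Basis. v (\<lambda>q. \<phi> q \<bullet> b) *\<^sub>R b)))"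

definition tangent_atlas ::
    "('m, 'e::euclidean_space) atlas \<Rightarrow> ('m tpoint, 'e \<times> 'e) atlas" where
  "tangent_atlas A = tangent_chart A ` A"

definition vector_field :: "('m, 'e::euclidean_space) atlas \<Rightarrow> ('m \<Rightarrow> 'm tvec) \<Rightarrow> bool" where
  "vector_field A X \<longleftrightarrow> smooth_map A (tangent_atlas A) (\<lambda>p. (p, X p))"

definition lie_bracket ::
    "('m, 'e::euclidean_space) atlas \<Rightarrow> ('m \<Rightarrow> 'm tvec) \<Rightarrow> ('m \<Rightarrow> 'm tvec) \<Rightarrow> 'm \<Rightarrow> 'm tvec" where
  "lie_bracket A X Y p =
     (\<lambda>f. if smooth_at A euclid f p then X p (\<lambda>q. Y q f) - Y p (\<lambda>q. X q f) else 0)"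


section \<open>The slit tangent bundle and the pullback bundle\<close>

text \<open>
  The slit bundle consists of the nonzero tangent vectors; \<open>fst\<close> is its projection \<open>\<pi>\<close> to the
  base.
\<close>

definition slit :: "('m, 'e::euclidean_space) atlas \<Rightarrow> 'm tpoint set" where
  "slit A = {(p, y). p \<in> points A \<and> y \<in> tangent_space A p \<and> y \<noteq> tzero}"

definition slit_atlas ::
    "('m, 'e::euclidean_space) atlas \<Rightarrow> ('m tpoint, 'e \<times> 'e) atlas" where
  "slit_atlas A = (\<lambda>(U, \<phi>). (U \<inter> slit A, \<phi>)) ` tangent_atlas A"

text \<open>
  The fibre over \<open>u\<close> of the pullback of the tangent bundle is \<open>{u} \<times> tangent_space A (fst u)\<close>.
  The redundant first component is dropped throughout: a section is a function \<open>Y\<close> with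
  \<open>Y u \<in> tangent_space A (fst u)\<close>, and it is smooth iff it is smooth as a map into the tangent
  bundle over \<open>\<pi>\<close>. Values outside of the slit bundle are irrelevant.
\<close>

definition pi_vector_field ::
    "('m, 'e::euclidean_space) atlas \<Rightarrow> ('m tpoint \<Rightarrow> 'm tvec) \<Rightarrow> bool" where
  "pi_vector_field A Y \<longleftrightarrow>
     smooth_map (slit_atlas A) (tangent_atlas A) (\<lambda>u. (fst u, Y u))"

definition eta :: "'m tpoint \<Rightarrow> 'm tvec" where
  "eta u = snd u"

definition rho ::
    "('m, 'e::euclidean_space) atlas \<Rightarrow> 'm tpoint \<Rightarrow> 'm tpoint tvec \<Rightarrow> 'm tvec" where
  "rho A u \<xi> = differential A fst u \<xi>"

definition gamma ::
    "('m, 'e::euclidean_space) atlas \<Rightarrow> 'm tpoint \<Rightarrow> 'm tvec \<Rightarrow> 'm tpoint tvec" where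
  "gamma A u v = velocity (slit_atlas A) (\<lambda>t. (fst u, tadd (snd u) (tscale t v)))"


section \<open>Finsler structures\<close>

text \<open>The Hessian of \<open>L\<^sup>2/2\<close> on the fibre through \<open>u\<close>: \<open>\<partial>\<^sub>s \<partial>\<^sub>t (L (u + s v + t w))\<^sup>2/2\<close> at \<open>0\<close>.\<close>

definition finsler_metric ::
    "('m tpoint \<Rightarrow> real) \<Rightarrow> 'm tpoint \<Rightarrow> 'm tvec \<Rightarrow> 'm tvec \<Rightarrow> real" where
  "finsler_metric L u v w =
     deriv (\<lambda>s. deriv (\<lambda>t.
       (L (fst u, tadd (snd u) (tadd (tscale s v) (tscale t w))))\<^sup>2 / 2) 0) 0"

definition finsler_structure ::
    "('m, 'e::euclidean_space) atlas \<Rightarrow> ('m tpoint \<Rightarrow> real) \<Rightarrow> bool" where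
  "finsler_structure A L \<longleftrightarrow>
     (\<forall>u\<in>slit A. L u > 0) \<and>
     smooth_map (slit_atlas A) euclid L \<and>
     (\<forall>(p, y)\<in>slit A. \<forall>k>0. L (p, tscale k y) = k * L (p, y)) \<and>
     (\<forall>u\<in>slit A. \<forall>v\<in>tangent_space A (fst u). v \<noteq> tzero \<longrightarrow> finsler_metric L u v v > 0)"


section \<open>Connections in the pullback bundle\<close>

text \<open>
  \<open>D u \<xi> Y\<close> is the covariant derivative of the \<open>\<pi>\<close>-vector field \<open>Y\<close> in the direction of the
  tangent vector \<open>\<xi>\<close> of the slit bundle at \<open>u\<close>; being defined for single vectors \<open>\<xi>\<close>, it is
  tensorial in the direction. Homogeneity in \<open>Y\<close> is the Leibniz rule for constant \<open>f\<close>.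
\<close>

type_synonym 'm connection =
  "'m tpoint \<Rightarrow> 'm tpoint tvec \<Rightarrow> ('m tpoint \<Rightarrow> 'm tvec) \<Rightarrow> 'm tvec"

definition linear_connection ::
    "('m, 'e::euclidean_space) atlas \<Rightarrow> 'm connection \<Rightarrow> bool" where
  "linear_connection A D \<longleftrightarrow>
     (\<forall>u\<in>slit A. \<forall>\<xi>\<in>tangent_space (slit_atlas A) u. \<forall>Y. pi_vector_field A Y \<longrightarrow>
        D u \<xi> Y \<in> tangent_space A (fst u)) \<and>
     (\<forall>u\<in>slit A. \<forall>\<xi>\<in>tangent_space (slit_atlas A) u. \<forall>\<zeta>\<in>tangent_space (slit_atlas A) u.
        \<forall>a b Y. pi_vector_field A Y \<longrightarrow>
        D u (tadd (tscale a \<xi>) (tscale b \<zeta>)) Y = tadd (tscale a (D u \<xi> Y)) (tscale b (D u \<zeta> Y))) \<and>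
     (\<forall>u\<in>slit A. \<forall>\<xi>\<in>tangent_space (slit_atlas A) u.
        \<forall>Y Z. pi_vector_field A Y \<longrightarrow> pi_vector_field A Z \<longrightarrow>
        D u \<xi> (\<lambda>z. tadd (Y z) (Z z)) = tadd (D u \<xi> Y) (D u \<xi> Z)) \<and>
     (\<forall>u\<in>slit A. \<forall>\<xi>\<in>tangent_space (slit_atlas A) u.
        \<forall>f Y. smooth_map (slit_atlas A) euclid f \<longrightarrow> pi_vector_field A Y \<longrightarrow>
        D u \<xi> (\<lambda>z. tscale (f z) (Y z)) = tadd (tscale (\<xi> f) (Y u)) (tscale (f u) (D u \<xi> Y))) \<and>
     (\<forall>X Y. vector_field (slit_atlas A) X \<longrightarrow> pi_vector_field A Y \<longrightarrow>
        pi_vector_field A (\<lambda>u. D u (X u) Y))"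

definition connection_map ::
    "'m connection \<Rightarrow> 'm tpoint \<Rightarrow> 'm tpoint tvec \<Rightarrow> 'm tvec" where
  "connection_map D u \<xi> = D u \<xi> eta"

definition vertical ::
    "('m, 'e::euclidean_space) atlas \<Rightarrow> 'm tpoint \<Rightarrow> 'm tpoint tvec set" where
  "vertical A u = {\<xi>\<in>tangent_space (slit_atlas A) u. rho A u \<xi> = tzero}"

definition horizontal ::
    "('m, 'e::euclidean_space) atlas \<Rightarrow> 'm connection \<Rightarrow> 'm tpoint \<Rightarrow> 'm tpoint tvec set" where
  "horizontal A D u = {\<xi>\<in>tangent_space (slit_atlas A) u. connection_map D u \<xi> = tzero}"

definition regular_connection ::
    "('m, 'e::euclidean_space) atlas \<Rightarrow> 'm connection \<Rightarrow> bool" where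
  "regular_connection A D \<longleftrightarrow> linear_connection A D \<and>
     (\<forall>u\<in>slit A.
        vertical A u \<inter> horizontal A D u = {tzero} \<and>
        tangent_space (slit_atlas A) u = {tadd v h | v h. v \<in> vertical A u \<and> h \<in> horizontal A D u})"

definition beta ::
    "('m, 'e::euclidean_space) atlas \<Rightarrow> 'm connection \<Rightarrow> 'm tpoint \<Rightarrow> 'm tvec \<Rightarrow> 'm tpoint tvec" where
  "beta A D u = inv_into (horizontal A D u) (rho A u)"

definition torsion ::
    "('m, 'e::euclidean_space) atlas \<Rightarrow> 'm connection \<Rightarrow>
     ('m tpoint \<Rightarrow> 'm tpoint tvec) \<Rightarrow> ('m tpoint \<Rightarrow> 'm tpoint tvec) \<Rightarrow> 'm tpoint \<Rightarrow> 'm tvec" where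
  "torsion A D X Y u =
     tdiff (tdiff (D u (X u) (\<lambda>z. rho A z (Y z))) (D u (Y u) (\<lambda>z. rho A z (X z))))
           (rho A u (lie_bracket (slit_atlas A) X Y u))"

definition h_torsion ::
    "('m, 'e::euclidean_space) atlas \<Rightarrow> 'm connection \<Rightarrow>
     ('m tpoint \<Rightarrow> 'm tvec) \<Rightarrow> ('m tpoint \<Rightarrow> 'm tvec) \<Rightarrow> 'm tpoint \<Rightarrow> 'm tvec" where
  "h_torsion A D X Y = torsion A D (\<lambda>z. beta A D z (X z)) (\<lambda>z. beta A D z (Y z))"

definition hv_torsion ::
    "('m, 'e::euclidean_space) atlas \<Rightarrow> 'm connection \<Rightarrow>
     ('m tpoint \<Rightarrow> 'm tvec) \<Rightarrow> ('m tpoint \<Rightarrow> 'm tvec) \<Rightarrow> 'm tpoint \<Rightarrow> 'm tvec" where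
  "hv_torsion A D X Y = torsion A D (\<lambda>z. gamma A z (X z)) (\<lambda>z. beta A D z (Y z))"

definition metric_connection ::
    "('m, 'e::euclidean_space) atlas \<Rightarrow> ('m tpoint \<Rightarrow> real) \<Rightarrow> 'm connection \<Rightarrow> bool" where
  "metric_connection A L D \<longleftrightarrow>
     (\<forall>u\<in>slit A. \<forall>\<xi>\<in>tangent_space (slit_atlas A) u.
        \<forall>Y Z. pi_vector_field A Y \<longrightarrow> pi_vector_field A Z \<longrightarrow>
        \<xi> (\<lambda>z. finsler_metric L z (Y z) (Z z))
          - finsler_metric L u (D u \<xi> Y) (Z u) - finsler_metric L u (Y u) (D u \<xi> Z) = 0)"

definition cartan_connection ::
    "('m, 'e::euclidean_space) atlas \<Rightarrow> ('m tpoint \<Rightarrow> real) \<Rightarrow> 'm connection \<Rightarrow> bool" where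
  "cartan_connection A L D \<longleftrightarrow>
     regular_connection A D \<and>
     metric_connection A L D \<and>
     (\<forall>X Y. pi_vector_field A X \<longrightarrow> pi_vector_field A Y \<longrightarrow>
        (\<forall>u\<in>slit A. h_torsion A D X Y u = tzero)) \<and>
     (\<forall>X Y Z. pi_vector_field A X \<longrightarrow> pi_vector_field A Y \<longrightarrow> pi_vector_field A Z \<longrightarrow>
        (\<forall>u\<in>slit A. finsler_metric L u (hv_torsion A D X Y u) (Z u) =
                     finsler_metric L u (hv_torsion A D X Z u) (Y u)))"


section \<open>The \<open>\<pi>\<close>-exterior derivative\<close>

text \<open>A \<open>\<pi>\<close>-form \<open>\<omega>\<close> of order 1 assigns to \<open>u\<close> a linear form \<open>\<omega> u\<close> on \<open>tangent_space A (fst u)\<close>.\<close>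

definition pi_exterior_derivative ::
    "('m, 'e::euclidean_space) atlas \<Rightarrow> 'm connection \<Rightarrow> ('m tpoint \<Rightarrow> 'm tvec \<Rightarrow> real) \<Rightarrow>
     ('m tpoint \<Rightarrow> 'm tvec) \<Rightarrow> ('m tpoint \<Rightarrow> 'm tvec) \<Rightarrow> 'm tpoint \<Rightarrow> real" where
  "pi_exterior_derivative A D \<omega> Y Z u =
     beta A D u (Y u) (\<lambda>z. \<omega> z (Z z)) - beta A D u (Z u) (\<lambda>z. \<omega> z (Y z))
     - \<omega> u (rho A u (lie_bracket (slit_atlas A)
                        (\<lambda>z. beta A D z (Y z)) (\<lambda>z. beta A D z (Z z)) u))"

definition d_closed_form ::
    "('m, 'e::euclidean_space) atlas \<Rightarrow> 'm connection \<Rightarrow> ('m tpoint \<Rightarrow> 'm tvec \<Rightarrow> real) \<Rightarrow> bool" where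
  "d_closed_form A D \<omega> \<longleftrightarrow>
     (\<forall>Y Z. pi_vector_field A Y \<longrightarrow> pi_vector_field A Z \<longrightarrow>
        (\<forall>u\<in>slit A. pi_exterior_derivative A D \<omega> Y Z u = 0))"

definition d_closed_field ::
    "('m, 'e::euclidean_space) atlas \<Rightarrow> ('m tpoint \<Rightarrow> real) \<Rightarrow> 'm connection \<Rightarrow>
     ('m tpoint \<Rightarrow> 'm tvec) \<Rightarrow> bool" where
  "d_closed_field A L D X \<longleftrightarrow> d_closed_form A D (\<lambda>u w. finsler_metric L u (X u) w)"

definition A_operator ::
    "('m, 'e::euclidean_space) atlas \<Rightarrow> 'm connection \<Rightarrow>
     ('m tpoint \<Rightarrow> 'm tvec) \<Rightarrow> ('m tpoint \<Rightarrow> 'm tvec) \<Rightarrow> 'm tpoint \<Rightarrow> 'm tvec" where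
  "A_operator A D X Y u = D u (beta A D u (Y u)) X"

definition g_self_adjoint ::
    "('m, 'e::euclidean_space) atlas \<Rightarrow> ('m tpoint \<Rightarrow> real) \<Rightarrow>
     (('m tpoint \<Rightarrow> 'm tvec) \<Rightarrow> 'm tpoint \<Rightarrow> 'm tvec) \<Rightarrow> bool" where
  "g_self_adjoint A L F \<longleftrightarrow>
     (\<forall>Y Z. pi_vector_field A Y \<longrightarrow> pi_vector_field A Z \<longrightarrow>
        (\<forall>u\<in>slit A. finsler_metric L u (F Y u) (Z u) = finsler_metric L u (Y u) (F Z u)))"

end

theory Submission
  imports Defs
begin

text \<open>
  Since \<open>\<nabla>g = 0\<close>, differentiating \<open>g(X, Z)\<close> along \<open>\<beta>Y\<close> and \<open>g(X, Y)\<close> along \<open>\<beta>Z\<close> expresses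
  \<open>d(i\<^sub>X g)(Y, Z)\<close> through \<open>g(\<nabla>\<^sub>Y X, Z) - g(\<nabla>\<^sub>Z X, Y)\<close> and
  \<open>g(X, \<nabla>\<^sub>Y Z - \<nabla>\<^sub>Z Y - \<rho>[\<beta>Y, \<beta>Z])\<close>, where \<open>\<nabla>\<^sub>Y\<close> stands for the derivative along \<open>\<beta>Y\<close>;
  the last term vanishes because \<open>Q = 0\<close>. So the exterior derivative measures exactly the failure
  of self-adjointness. What has to be supplied is that \<open>\<beta>\<close> is a right inverse of \<open>\<rho>\<close> (curves in the
  base lift to the slit bundle), that \<open>g\<close> is bilinear and symmetric (it is a Hessian in each fibre),
  and that \<open>\<nabla>\<close> does not see the values of sections outside of the slit bundle.
\<close>

section \<open>Calculus of smooth maps\<close>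

lemma Ck_on_cong:
  assumes "open S" "Ck_on k S f" "\<And>x. x \<in> S \<Longrightarrow> f x = g x"
  shows "Ck_on k S g"
  using assms(2,3)
proof (induction k arbitrary: f g)
  case 0
  then show ?case by (auto cong: continuous_on_cong)
next
  case (Suc k)
  have d: "f differentiable (at x)" if "x \<in> S" for x using Suc.prems that by auto
  \<comment> \<open>A derivative at a point of the open set \<open>S\<close> depends only on values
    inside \<open>S\<close>, so \<open>f\<close> and \<open>g\<close> may differ elsewhere.\<close>
  have "g differentiable (at x)" if "x \<in> S" for x
    using d[OF that] Suc.prems(2) assms(1) that
    unfolding differentiable_def by (metis has_derivative_transform_within_open)
  moreover have "Ck_on k S (\<lambda>x. frechet_derivative g (at x) v)" for v
  proof (rule Suc.IH)
    show "Ck_on k S (\<lambda>x. frechet_derivative f (at x) v)" using Suc.prems by auto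
    show "frechet_derivative f (at x) v = frechet_derivative g (at x) v" if "x \<in> S" for x
      using frechet_derivative_transform_within_open[OF d[OF that] assms(1) that, of g] Suc.prems(2)
      by simp
  qed
  ultimately show ?case by simp
qed

lemma frechet_derivative_eqI: "(f has_derivative f') (at x) \<Longrightarrow> frechet_derivative f (at x) = f'"
  by (rule frechet_derivative_at[symmetric])

lemma has_derivative_affine:
  assumes "f differentiable (at (a + l x))" "bounded_linear l"
  shows "((\<lambda>x. f (a + l x)) has_derivative (\<lambda>h. frechet_derivative f (at (a + l x)) (l h))) (at x)"
proof -
  have "((\<lambda>x. a + l x) has_derivative l) (at x)"
    using bounded_linear_imp_has_derivative[OF assms(2), of "at x"]
    by (auto intro!: derivative_eq_intros)
  from diff_chain_at[OF this] assms(1)[unfolded frechet_derivative_works]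
  show ?thesis by (simp add: o_def)
qed

text \<open>For an affine inner map, the derivative of the composite in direction \<open>v\<close>
  is the derivative of \<open>f\<close> in the fixed direction \<open>l v\<close>, composed with the
  same affine map. The induction therefore closes without a product rule. Coordinate lines and
  inclusions of fibres are of this form.\<close>

lemma Ck_on_affine:
  assumes "open T" "bounded_linear l" "\<And>x. x \<in> T \<Longrightarrow> a + l x \<in> S" "Ck_on k S f"
  shows "Ck_on k T (\<lambda>x. f (a + l x))"
  using assms(4)
proof (induction k arbitrary: f)
  case 0
  have "continuous_on T (\<lambda>x. a + l x)"
    by (intro continuous_intros bounded_linear.continuous_on[OF assms(2)])
  then show ?case using 0 assms(3) by (auto intro: continuous_on_compose2[of S f])
next
  case (Suc k)
  have d: "((\<lambda>x. f (a + l x)) has_derivative (\<lambda>h. frechet_derivative f (at (a + l x)) (l h))) (at x)"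
    if "x \<in> T" for x
    using Suc.prems assms(3)[OF that] by (intro has_derivative_affine assms(2)) auto
  have "Ck_on k T (\<lambda>x. frechet_derivative (\<lambda>x. f (a + l x)) (at x) v)" for v
  proof (rule Ck_on_cong[OF assms(1)])
    show "Ck_on k T (\<lambda>x. frechet_derivative f (at (a + l x)) (l v))"
      using Suc.prems by (intro Suc.IH) auto
  qed (simp add: frechet_derivative_eqI[OF d])
  with d show ?case by (auto simp: differentiable_def)
qed

lemma Ck_on_bounded_linear:
  assumes "open S" "bounded_linear l" "Ck_on k S f"
  shows "Ck_on k S (\<lambda>x. l (f x))"
  using assms(3)
proof (induction k arbitrary: f)
  case 0
  then show ?case by (auto intro: bounded_linear.continuous_on[OF assms(2)])
next
  case (Suc k)
  have d: "((\<lambda>x. l (f x)) has_derivative (\<lambda>h. l (frechet_derivative f (at x) h))) (at x)"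
    if "x \<in> S" for x
    using Suc.prems that
    by (intro bounded_linear.has_derivative[OF assms(2)]) (auto simp: frechet_derivative_works)
  have "Ck_on k S (\<lambda>x. frechet_derivative (\<lambda>x. l (f x)) (at x) v)" for v
  proof (rule Ck_on_cong[OF assms(1)])
    show "Ck_on k S (\<lambda>x. l (frechet_derivative f (at x) v))"
      using Suc.prems by (intro Suc.IH) auto
  qed (simp add: frechet_derivative_eqI[OF d])
  with d show ?case by (auto simp: differentiable_def)
qed

lemma Ck_on_Pair:
  assumes "open S" "Ck_on k S f" "Ck_on k S g"
  shows "Ck_on k S (\<lambda>x. (f x, g x))"
  using assms(2,3)
proof (induction k arbitrary: f g)
  case 0
  then show ?case by (auto intro: continuous_on_Pair)
next
  case (Suc k)
  have d: "((\<lambda>x. (f x, g x)) has_derivative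
      (\<lambda>h. (frechet_derivative f (at x) h, frechet_derivative g (at x) h))) (at x)"
    if "x \<in> S" for x
    using Suc.prems that
    by (intro has_derivative_Pair) (auto simp: frechet_derivative_works)
  have "Ck_on k S (\<lambda>x. frechet_derivative (\<lambda>x. (f x, g x)) (at x) v)" for v
  proof (rule Ck_on_cong[OF assms(1)])
    show "Ck_on k S (\<lambda>x. (frechet_derivative f (at x) v, frechet_derivative g (at x) v))"
      using Suc.prems by (intro Suc.IH) auto
  qed (simp add: frechet_derivative_eqI[OF d])
  with d show ?case by (auto simp: differentiable_def)
qed

lemma Ck_on_const: "Ck_on k S (\<lambda>x. c)"
  by (induction k arbitrary: c) auto

lemma smooth_on_cong:
  "open S \<Longrightarrow> smooth_on S f \<Longrightarrow> (\<And>x. x \<in> S \<Longrightarrow> f x = g x) \<Longrightarrow> smooth_on S g"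
  unfolding smooth_on_def using Ck_on_cong[of S _ f g] by blast

lemma smooth_on_affine:
  "open T \<Longrightarrow> bounded_linear l \<Longrightarrow> (\<And>x. x \<in> T \<Longrightarrow> a + l x \<in> S) \<Longrightarrow> smooth_on S f \<Longrightarrow>
   smooth_on T (\<lambda>x. f (a + l x))"
  unfolding smooth_on_def using Ck_on_affine[of T l a S _ f] by blast

lemma smooth_on_bounded_linear:
  "open S \<Longrightarrow> bounded_linear l \<Longrightarrow> smooth_on S f \<Longrightarrow> smooth_on S (\<lambda>x. l (f x))"
  unfolding smooth_on_def by (blast intro: Ck_on_bounded_linear)

lemma smooth_on_Pair:
  "open S \<Longrightarrow> smooth_on S f \<Longrightarrow> smooth_on S g \<Longrightarrow> smooth_on S (\<lambda>x. (f x, g x))"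
  unfolding smooth_on_def by (blast intro: Ck_on_Pair)

lemma smooth_on_const: "smooth_on S (\<lambda>x. c)"
  unfolding smooth_on_def by (blast intro: Ck_on_const)

lemma smooth_on_differentiable: "smooth_on S f \<Longrightarrow> x \<in> S \<Longrightarrow> f differentiable (at x)"
  unfolding smooth_on_def by (metis Ck_on.simps(2))

lemma smooth_on_frechet_derivative:
  "smooth_on S f \<Longrightarrow> smooth_on S (\<lambda>x. frechet_derivative f (at x) v)"
  unfolding smooth_on_def by (metis Ck_on.simps(2))

lemma smooth_on_continuous_on: "smooth_on S f \<Longrightarrow> continuous_on S f"
  unfolding smooth_on_def by (metis Ck_on.simps(1))

section \<open>Derivatives along lines and symmetry of second derivatives\<close>

lemma DERIV_frechet_line:
  fixes f :: "'a::real_normed_vector \<Rightarrow> real"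
  assumes "f differentiable (at (a + t *\<^sub>R v))"
  shows "((\<lambda>t. f (a + t *\<^sub>R v)) has_field_derivative frechet_derivative f (at (a + t *\<^sub>R v)) v) (at t)"
proof -
  have "linear (frechet_derivative f (at (a + t *\<^sub>R v)))"
    using assms by (rule linear_frechet_derivative)
  then have "(\<lambda>h. frechet_derivative f (at (a + t *\<^sub>R v)) (h *\<^sub>R v)) =
      (*) (frechet_derivative f (at (a + t *\<^sub>R v)) v)"
    by (simp add: linear_scale fun_eq_iff)
  with has_derivative_affine[OF assms bounded_linear_scaleR_left] show ?thesis
    by (simp add: has_field_derivative_def)
qed

text \<open>
  The second difference is symmetric in \<open>v\<close> and \<open>w\<close>, so this limit yields the symmetry of second
  derivatives; the mean value theorem is applied first along \<open>v\<close> and then along \<open>w\<close>.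
\<close>

lemma second_difference_tendsto:
  fixes f :: "'a::real_normed_vector \<Rightarrow> real"
  assumes "open S" "x \<in> S" "smooth_on S f"
  shows "((\<lambda>r. (f (x + r *\<^sub>R v + r *\<^sub>R w) - f (x + r *\<^sub>R v) - f (x + r *\<^sub>R w) + f x) / r\<^sup>2)
    \<longlongrightarrow> frechet_derivative (\<lambda>z. frechet_derivative f (at z) v) (at x) w) (at_right 0)"
    (is "(?q \<longlongrightarrow> ?l) _")
proof (rule tendstoI)
  fix e :: real assume e: "0 < e"
  define f1 where "f1 = (\<lambda>z. frechet_derivative f (at z) v)"
  define f2 where "f2 = (\<lambda>z. frechet_derivative f1 (at z) w)"
  have s1: "smooth_on S f1" and s2: "smooth_on S f2"
    unfolding f1_def f2_def by (intro smooth_on_frechet_derivative assms)+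
  have "isCont f2 x"
    using smooth_on_continuous_on[OF s2] assms by (simp add: continuous_on_eq_continuous_at)
  then have "\<forall>\<^sub>F z in nhds x. dist (f2 z) (f2 x) < e"
    using tendstoD[OF _ e, of f2 "f2 x" "nhds x"] by (simp add: isCont_def tendsto_at_iff_tendsto_nhds)
  then have "\<forall>\<^sub>F z in nhds x. z \<in> S \<and> dist (f2 z) (f2 x) < e"
    using eventually_nhds_in_open[OF assms(1,2)] by eventually_elim simp
  then obtain d where d: "d > 0" "\<And>z. dist z x < d \<Longrightarrow> z \<in> S \<and> dist (f2 z) (f2 x) < e"
    unfolding eventually_nhds_metric by blast
  \<comment> \<open>For coefficients in \<open>[0, D)\<close> the parallelogram spanned by
    \<open>v\<close> and \<open>w\<close> at \<open>x\<close> stays in the ball of radius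
    \<open>d\<close>. The summand 1 keeps the denominator positive when both vectors vanish.\<close>
  define D where "D = d / (norm v + norm w + 1)"
  have D: "D > 0" using d unfolding D_def by (simp add: add_nonneg_pos)
  have near: "dist (x + a *\<^sub>R v + b *\<^sub>R w) x < d" if "0 \<le> a" "a < D" "0 \<le> b" "b < D" for a b
  proof -
    have "dist (x + a *\<^sub>R v + b *\<^sub>R w) x \<le> a * norm v + b * norm w"
      using that norm_triangle_ineq[of "a *\<^sub>R v" "b *\<^sub>R w"] by (simp add: dist_norm add.assoc)
    also have "\<dots> \<le> D * norm v + D * norm w"
      using that by (intro add_mono mult_right_mono) auto
    also have "\<dots> < D * (norm v + norm w + 1)" using D by (simp add: algebra_simps)
    also have "\<dots> = d"
    proof -
      have "norm v + norm w + 1 > 0" by (simp add: add_nonneg_pos)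
      then show ?thesis unfolding D_def by simp
    qed
    finally show ?thesis .
  qed
  have "dist (?q r) ?l < e" if r: "0 < r" "r < D" for r
  proof -
    \<comment> \<open>The increment of \<open>g\<close> from 0 to \<open>r\<close> is the second
      difference.\<close>
    define g where "g = (\<lambda>t. f (x + r *\<^sub>R w + t *\<^sub>R v) - f (x + t *\<^sub>R v))"
    have dg: "(g has_real_derivative
        f1 (x + r *\<^sub>R w + t *\<^sub>R v) - f1 (x + t *\<^sub>R v)) (at t)" if "0 \<le> t" "t \<le> r" for t
    proof -
      have "x + r *\<^sub>R w + t *\<^sub>R v \<in> S" "x + t *\<^sub>R v \<in> S"
        using d(2)[OF near[of t r]] d(2)[OF near[of t 0]] that r by (auto simp: algebra_simps)
      then show ?thesis unfolding g_def f1_def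
        by (intro DERIV_diff DERIV_frechet_line smooth_on_differentiable[OF assms(3)])
    qed
    obtain t where t: "0 < t" "t < r"
      "g r - g 0 = (r - 0) * (f1 (x + r *\<^sub>R w + t *\<^sub>R v) - f1 (x + t *\<^sub>R v))"
      using MVT2[OF r(1) dg] by auto
    have dh: "((\<lambda>b. f1 (x + t *\<^sub>R v + b *\<^sub>R w)) has_real_derivative
        f2 (x + t *\<^sub>R v + b *\<^sub>R w)) (at b)" if "0 \<le> b" "b \<le> r" for b
      unfolding f2_def using d(2)[OF near[of t b]] that r t
      by (intro DERIV_frechet_line smooth_on_differentiable[OF s1]) auto
    obtain b where b: "0 < b" "b < r"
      "f1 (x + t *\<^sub>R v + r *\<^sub>R w) - f1 (x + t *\<^sub>R v + 0 *\<^sub>R w) = (r - 0) * f2 (x + t *\<^sub>R v + b *\<^sub>R w)"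
      using MVT2[OF r(1) dh] by auto
    have "g r - g 0 = r\<^sup>2 * f2 (x + t *\<^sub>R v + b *\<^sub>R w)"
      using t(3) b(3) by (simp add: algebra_simps power2_eq_square)
    moreover have "g r - g 0 = f (x + r *\<^sub>R v + r *\<^sub>R w) - f (x + r *\<^sub>R v) - f (x + r *\<^sub>R w) + f x"
      unfolding g_def by (simp add: algebra_simps)
    ultimately have "?q r = f2 (x + t *\<^sub>R v + b *\<^sub>R w)" using r by simp
    moreover have "dist (f2 (x + t *\<^sub>R v + b *\<^sub>R w)) (f2 x) < e"
      using d(2)[OF near[of t b]] t b r by auto
    ultimately show ?thesis by (simp add: f2_def f1_def)
  qed
  then show "\<forall>\<^sub>F r in at_right 0. dist (?q r) ?l < e"
    using D by (auto simp: eventually_at_right_field intro!: exI[of _ D])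
qed

lemma frechet_derivative_commute:
  fixes f :: "'a::real_normed_vector \<Rightarrow> real"
  assumes "open S" "x \<in> S" "smooth_on S f"
  shows "frechet_derivative (\<lambda>z. frechet_derivative f (at z) v) (at x) w =
    frechet_derivative (\<lambda>z. frechet_derivative f (at z) w) (at x) v"
proof (rule tendsto_unique[OF _ second_difference_tendsto[OF assms]])
  show "((\<lambda>r. (f (x + r *\<^sub>R v + r *\<^sub>R w) - f (x + r *\<^sub>R v) - f (x + r *\<^sub>R w) + f x) / r\<^sup>2) \<longlongrightarrow>
      frechet_derivative (\<lambda>z. frechet_derivative f (at z) w) (at x) v) (at_right 0)"
    using second_difference_tendsto[OF assms, of w v] by (simp add: algebra_simps)
qed simp

text \<open>The left side is the shape of \<open>finsler_metric\<close> in fibre coordinates. The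
  right side trades the nested one-variable derivatives for Frechet derivatives, whose linearity and
  symmetry are available.\<close>

lemma second_derivative_half_square:
  fixes f :: "'a::real_normed_vector \<Rightarrow> real"
  assumes "open S" "x \<in> S" "smooth_on S f"
  shows "deriv (\<lambda>s. deriv (\<lambda>t. (f (x + s *\<^sub>R v + t *\<^sub>R w))\<^sup>2 / 2) 0) 0 =
    frechet_derivative f (at x) v * frechet_derivative f (at x) w +
    f x * frechet_derivative (\<lambda>z. frechet_derivative f (at z) w) (at x) v"
proof -
  let ?f1 = "\<lambda>z. frechet_derivative f (at z) w"
  have inner: "deriv (\<lambda>t. (f (x + s *\<^sub>R v + t *\<^sub>R w))\<^sup>2 / 2) 0 =
      f (x + s *\<^sub>R v) * ?f1 (x + s *\<^sub>R v)" if "x + s *\<^sub>R v \<in> S" for s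
  proof -
    have "((\<lambda>t. f (x + s *\<^sub>R v + t *\<^sub>R w)) has_field_derivative ?f1 (x + s *\<^sub>R v)) (at 0)"
      using DERIV_frechet_line[of f "x + s *\<^sub>R v" 0 w] smooth_on_differentiable[OF assms(3) that]
      by simp
    then have "((\<lambda>t. (f (x + s *\<^sub>R v + t *\<^sub>R w))\<^sup>2 / 2) has_field_derivative
        f (x + s *\<^sub>R v) * ?f1 (x + s *\<^sub>R v)) (at 0)"
      by (auto intro!: derivative_eq_intros)
    then show ?thesis by (rule DERIV_imp_deriv)
  qed
  \<comment> \<open>The formula \<open>inner\<close> is known only while \<open>x + s v\<close> lies
    in \<open>S\<close>. This is enough, because the outer derivative at 0 sees only
    \<open>s\<close> near 0.\<close>
  have "((\<lambda>s. x + s *\<^sub>R v) \<longlongrightarrow> x + 0 *\<^sub>R v) (nhds 0)"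
    by (intro tendsto_intros filterlim_ident)
  then have "\<forall>\<^sub>F s in nhds 0. x + s *\<^sub>R v \<in> S"
    using topological_tendstoD[OF _ assms(1), of _ "x + 0 *\<^sub>R v" "nhds 0"] assms(2) by simp
  then have "\<forall>\<^sub>F s in nhds 0. deriv (\<lambda>t. (f (x + s *\<^sub>R v + t *\<^sub>R w))\<^sup>2 / 2) 0 =
      f (x + s *\<^sub>R v) * ?f1 (x + s *\<^sub>R v)"
    by eventually_elim (rule inner)
  then have "deriv (\<lambda>s. deriv (\<lambda>t. (f (x + s *\<^sub>R v + t *\<^sub>R w))\<^sup>2 / 2) 0) 0 =
      deriv (\<lambda>s. f (x + s *\<^sub>R v) * ?f1 (x + s *\<^sub>R v)) 0"
    by (rule deriv_cong_ev) simp
  also have "\<dots> = frechet_derivative f (at x) v * ?f1 x + f x * frechet_derivative ?f1 (at x) v"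
  proof (rule DERIV_imp_deriv)
    have "((\<lambda>s. f (x + s *\<^sub>R v)) has_field_derivative frechet_derivative f (at x) v) (at 0)"
      using DERIV_frechet_line[of f x 0 v] smooth_on_differentiable[OF assms(3,2)] by simp
    moreover have "((\<lambda>s. ?f1 (x + s *\<^sub>R v)) has_field_derivative frechet_derivative ?f1 (at x) v) (at 0)"
      using DERIV_frechet_line[of ?f1 x 0 v]
        smooth_on_differentiable[OF smooth_on_frechet_derivative[OF assms(3)] assms(2)] by simp
    ultimately show "((\<lambda>s. f (x + s *\<^sub>R v) * ?f1 (x + s *\<^sub>R v)) has_field_derivative
        frechet_derivative f (at x) v * ?f1 x + f x * frechet_derivative ?f1 (at x) v) (at 0)"
      by (auto intro!: derivative_eq_intros)
  qed
  finally show ?thesis .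
qed

section \<open>Charts, velocities and the slit bundle\<close>

lemma inv_into_UNIV_ident [simp]: "inv_into UNIV (\<lambda>x. x) x = x"
  by (rule inv_into_f_f) (auto simp: inj_on_def)

lemma smooth_at_real_iff:
  "smooth_at A (euclid :: ('f, 'f::euclidean_space) atlas) f p \<longleftrightarrow> p \<in> points A \<and>
     (\<forall>(U, \<phi>)\<in>A. p \<in> U \<longrightarrow>
        (\<exists>S. open S \<and> \<phi> p \<in> S \<and> S \<subseteq> \<phi> ` U \<and> smooth_on S (\<lambda>x. f (inv_into U \<phi> x))))"
  unfolding smooth_at_def by (simp add: euclid_def points_def)

lemma smooth_at_curve_iff:
  "smooth_at (euclid :: (real, real) atlas) A c t \<longleftrightarrow> c t \<in> points A \<and>
     (\<forall>(V, \<psi>)\<in>A. c t \<in> V \<longrightarrow>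
        (\<exists>S. open S \<and> t \<in> S \<and> (\<forall>x\<in>S. c x \<in> V) \<and> smooth_on S (\<lambda>x. \<psi> (c x))))"
  unfolding smooth_at_def by (simp add: euclid_def points_def)

text \<open>The local expression in a chart evaluates the map only at points of the chart domain.
  This allows sections and functions to be altered outside of the slit bundle.\<close>

lemma smooth_map_cong:
  assumes "smooth_map A B f" "\<And>p. p \<in> points A \<Longrightarrow> f p = g p"
  shows "smooth_map A B g"
  unfolding smooth_map_def smooth_at_def
proof (intro ballI conjI impI; (elim conjE)?; clarify?)
  fix p assume p: "p \<in> points A"
  with assms have f: "smooth_at A B f p" and eq: "f p = g p" by (auto simp: smooth_map_def)
  then show "g p \<in> points B" by (simp add: smooth_at_def)
  fix U \<phi> V \<psi>
  assume U: "(U, \<phi>) \<in> A" "p \<in> U" and V: "(V, \<psi>) \<in> B" "g p \<in> V"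
  with f eq obtain S where S: "open S" "\<phi> p \<in> S" "S \<subseteq> \<phi> ` U"
    "\<forall>x\<in>S. f (inv_into U \<phi> x) \<in> V" "smooth_on S (\<lambda>x. \<psi> (f (inv_into U \<phi> x)))"
    unfolding smooth_at_def by fastforce
  have eq: "f (inv_into U \<phi> x) = g (inv_into U \<phi> x)" if "x \<in> S" for x
    using S(3) U(1) that inv_into_into[of x \<phi> U] by (intro assms(2)) (force simp: points_def)
  moreover have "smooth_on S (\<lambda>x. \<psi> (g (inv_into U \<phi> x)))"
    using S(5) by (rule smooth_on_cong[OF S(1)]) (simp add: eq)
  ultimately show "\<exists>S. open S \<and> \<phi> p \<in> S \<and> S \<subseteq> \<phi> ` U \<and> (\<forall>x\<in>S. g (inv_into U \<phi> x) \<in> V) \<and>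
      smooth_on S (\<lambda>x. \<psi> (g (inv_into U \<phi> x)))"
    using S by (intro exI[of _ S]) auto
qed

definition chart_coord :: "('m \<Rightarrow> 'e::euclidean_space) \<Rightarrow> 'm tvec \<Rightarrow> 'e" where
  "chart_coord \<phi> v = (\<Sum>b\<in>Basis. v (\<lambda>q. \<phi> q \<bullet> b) *\<^sub>R b)"

text \<open>The coordinate vector with components \<open>w\<close> at \<open>p\<close>. The default
  0 on functions that are not smooth at \<open>p\<close> matches \<open>velocity\<close>, so that
  tangent vectors can be compared as functions.\<close>

definition chart_vec ::
    "('m, 'e::euclidean_space) atlas \<Rightarrow> ('m, 'e) chart \<Rightarrow> 'm \<Rightarrow> 'e \<Rightarrow> 'm tvec" where
  "chart_vec A = (\<lambda>(U, \<phi>) p w f.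
     if smooth_at A euclid f p then frechet_derivative (\<lambda>x. f (inv_into U \<phi> x)) (at (\<phi> p)) w else 0)"

lemma smooth_at_real_differentiable:
  assumes "smooth_at A euclid f p" "(U, \<phi>) \<in> A" "p \<in> U"
  shows "(\<lambda>x. f (inv_into U \<phi> x)) differentiable (at (\<phi> p))"
  using assms unfolding smooth_at_real_iff by (blast intro: smooth_on_differentiable)

lemma has_derivative_scaleR_imp_DERIV:
  assumes "((\<lambda>t. f t) has_derivative (\<lambda>h. F (h *\<^sub>R w))) (at t)" "linear (F :: _ \<Rightarrow> real)"
  shows "(f has_field_derivative F w) (at t)"
proof -
  have "(\<lambda>h. F (h *\<^sub>R w)) = (*) (F w)" using assms(2) by (simp add: linear_scale fun_eq_iff)
  with assms(1) show ?thesis by (simp add: has_field_derivative_def)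
qed

text \<open>Chain rule for the chart expression of \<open>f\<close> composed with the curve
  \<open>\<phi> \<circ> c\<close>; near 0 the curve stays in \<open>U\<close>, where inserting the
  chart and its inverse changes nothing.\<close>

lemma velocity_eq_chart_vec:
  assumes "smooth_at euclid A c 0" "(U, \<phi>) \<in> A" "inj_on \<phi> U" "c 0 \<in> U"
  shows "velocity A c = chart_vec A (U, \<phi>) (c 0) (vector_derivative (\<lambda>t. \<phi> (c t)) (at 0))"
proof (rule ext)
  fix f
  let ?w = "vector_derivative (\<lambda>t. \<phi> (c t)) (at 0)"
  show "velocity A c f = chart_vec A (U, \<phi>) (c 0) ?w f"
  proof (cases "smooth_at A euclid f (c 0)")
    case True
    let ?F = "\<lambda>x. f (inv_into U \<phi> x)"
    obtain S where S: "open S" "0 \<in> S" "\<And>t. t \<in> S \<Longrightarrow> c t \<in> U" "smooth_on S (\<lambda>t. \<phi> (c t))"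
      using assms unfolding smooth_at_curve_iff by fast
    have "(\<lambda>t. \<phi> (c t)) differentiable (at 0)" by (rule smooth_on_differentiable[OF S(4,2)])
    then have 1: "((\<lambda>t. \<phi> (c t)) has_derivative (\<lambda>h. h *\<^sub>R ?w)) (at 0)"
      unfolding vector_derivative_works has_vector_derivative_def .
    have d: "?F differentiable (at (\<phi> (c 0)))"
      using True assms by (intro smooth_at_real_differentiable)
    from diff_chain_at[OF 1 d[unfolded frechet_derivative_works]]
    have "((\<lambda>t. ?F (\<phi> (c t))) has_derivative
        (\<lambda>h. frechet_derivative ?F (at (\<phi> (c 0))) (h *\<^sub>R ?w))) (at 0)"
      by (simp add: o_def)
    then have "((\<lambda>t. f (c t)) has_derivative
        (\<lambda>h. frechet_derivative ?F (at (\<phi> (c 0))) (h *\<^sub>R ?w))) (at 0)"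
      by (rule has_derivative_transform_within_open[OF _ S(1,2)]) (simp add: S(3) assms(3))
    then have "((\<lambda>t. f (c t)) has_field_derivative frechet_derivative ?F (at (\<phi> (c 0))) ?w) (at 0)"
      by (rule has_derivative_scaleR_imp_DERIV) (rule linear_frechet_derivative[OF d])
    then show ?thesis using True by (simp add: velocity_def chart_vec_def DERIV_imp_deriv)
  qed (simp add: velocity_def chart_vec_def)
qed

text \<open>A curve smooth at 0 stays in a chart domain for small times, so values of
  \<open>f\<close> off the manifold do not enter. The case of interest is the indicator function of
  the slit bundle.\<close>

lemma velocity_const:
  assumes "smooth_at euclid A c 0" "\<And>p. p \<in> points A \<Longrightarrow> f p = k"
  shows "velocity A c f = 0"
proof -
  obtain V \<psi> where V: "(V, \<psi>) \<in> A" "c 0 \<in> V"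
    using assms(1) unfolding smooth_at_curve_iff by (auto simp: points_def)
  then obtain S where S: "open S" "0 \<in> S" "\<And>t. t \<in> S \<Longrightarrow> c t \<in> V"
    using assms(1) unfolding smooth_at_curve_iff by fast
  have "((\<lambda>t. f (c t)) has_field_derivative 0) (at 0)"
  proof (rule DERIV_const[THEN has_field_derivative_transform_within_open[OF _ S(1,2)]])
    show "k = f (c t)" if "t \<in> S" for t
      using S(3)[OF that] V(1) assms(2)[of "c t"] by (force simp: points_def)
  qed
  then show ?thesis by (simp add: velocity_def DERIV_imp_deriv)
qed

section \<open>Explicit charts of the slit bundle\<close>

definition slit_dom :: "('m, 'e::euclidean_space) atlas \<Rightarrow> 'm set \<Rightarrow> 'm tpoint set" where
  "slit_dom A U = {(p, v). p \<in> U \<and> v \<in> tangent_space A p} \<inter> slit A"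

definition slit_map :: "('m \<Rightarrow> 'e::euclidean_space) \<Rightarrow> 'm tpoint \<Rightarrow> 'e \<times> 'e" where
  "slit_map \<phi> = (\<lambda>(p, v). (\<phi> p, chart_coord \<phi> v))"

lemma slit_atlas_eq: "slit_atlas A = (\<lambda>(U, \<phi>). (slit_dom A U, slit_map \<phi>)) ` A"
  unfolding slit_atlas_def tangent_atlas_def tangent_chart_def slit_dom_def slit_map_def
    chart_coord_def by (force simp: image_image split_beta)

lemma points_slit_atlas: "points (slit_atlas A) = slit A"
proof -
  have "points (slit_atlas A) = (\<Union>(U, \<phi>)\<in>A. slit_dom A U)"
    by (auto simp: points_def slit_atlas_eq)
  then show ?thesis by (force simp: points_def slit_dom_def slit_def)
qed

section \<open>Coordinate lines and tangent spaces of a smooth manifold\<close>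

locale manifold =
  fixes A :: "('m, 'e::euclidean_space) atlas"
  assumes smooth: "smooth_manifold A"
begin

lemma chart_inj: "(U, \<phi>) \<in> A \<Longrightarrow> inj_on \<phi> U"
  and chart_open: "(U, \<phi>) \<in> A \<Longrightarrow> open (\<phi> ` U)"
  using smooth unfolding smooth_manifold_def by fast+

lemma overlap_open: "(U, \<phi>) \<in> A \<Longrightarrow> (V, \<psi>) \<in> A \<Longrightarrow> open (\<phi> ` (U \<inter> V))"
  and transition_smooth: "(U, \<phi>) \<in> A \<Longrightarrow> (V, \<psi>) \<in> A \<Longrightarrow>
    smooth_on (\<phi> ` (U \<inter> V)) (\<lambda>x. \<psi> (inv_into U \<phi> x))"
  using smooth unfolding smooth_manifold_def by fast+

lemma transition_differentiable:
  "(U, \<phi>) \<in> A \<Longrightarrow> (V, \<psi>) \<in> A \<Longrightarrow> p \<in> U \<Longrightarrow> p \<in> V \<Longrightarrow>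
   (\<lambda>x. \<psi> (inv_into U \<phi> x)) differentiable (at (\<phi> p))"
  by (rule smooth_on_differentiable[OF transition_smooth]) auto

lemma mem_points: "(U, \<phi>) \<in> A \<Longrightarrow> p \<in> U \<Longrightarrow> p \<in> points A"
  by (auto simp: points_def)

text \<open>The image of a chart overlap is open, so a coordinate line through
  \<open>\<phi> p\<close> remains in it for small times.\<close>

lemma line_preimage:
  assumes "(U, \<phi>) \<in> A" "(V, \<psi>) \<in> A" "p \<in> U" "p \<in> V"
  shows "\<exists>S. open S \<and> (0::real) \<in> S \<and>
    (\<forall>t\<in>S. \<phi> p + t *\<^sub>R w \<in> \<phi> ` (U \<inter> V) \<and> inv_into U \<phi> (\<phi> p + t *\<^sub>R w) \<in> U \<inter> V)"
proof (intro exI conjI ballI)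
  let ?S = "(\<lambda>t. \<phi> p + t *\<^sub>R w) -` (\<phi> ` (U \<inter> V))"
  show "open ?S"
    by (rule open_vimage[OF overlap_open[OF assms(1,2)]]) (intro continuous_intros)
  show "0 \<in> ?S" using assms by auto
  fix t assume "t \<in> ?S"
  then show m: "\<phi> p + t *\<^sub>R w \<in> \<phi> ` (U \<inter> V)" by simp
  then show "inv_into U \<phi> (\<phi> p + t *\<^sub>R w) \<in> U \<inter> V"
    using chart_inj[OF assms(1)] by auto
qed

text \<open>In any other chart the curve is a transition map composed with an affine map.\<close>

lemma smooth_at_line:
  assumes "(U, \<phi>) \<in> A" "p \<in> U"
  shows "smooth_at euclid A (\<lambda>t. inv_into U \<phi> (\<phi> p + t *\<^sub>R w)) 0"
proof -
  have p: "inv_into U \<phi> (\<phi> p) = p" using assms chart_inj by simp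
  show ?thesis unfolding smooth_at_curve_iff
  proof (intro conjI ballI; clarify?)
    show "inv_into U \<phi> (\<phi> p + 0 *\<^sub>R w) \<in> points A" using p assms by (simp add: mem_points)
    fix V \<psi> assume V: "(V, \<psi>) \<in> A" and "inv_into U \<phi> (\<phi> p + 0 *\<^sub>R w) \<in> V"
    then have "p \<in> V" using p by simp
    then obtain S where
      S: "open S" "(0::real) \<in> S" "\<And>t. t \<in> S \<Longrightarrow> \<phi> p + t *\<^sub>R w \<in> \<phi> ` (U \<inter> V)"
      "\<And>t. t \<in> S \<Longrightarrow> inv_into U \<phi> (\<phi> p + t *\<^sub>R w) \<in> U \<inter> V"
      using line_preimage[OF assms(1) V assms(2), of w] by meson
    moreover have "smooth_on S (\<lambda>t. \<psi> (inv_into U \<phi> (\<phi> p + t *\<^sub>R w)))"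
      by (rule smooth_on_affine[OF S(1) bounded_linear_scaleR_left S(3)
            transition_smooth[OF assms(1) V]])
    ultimately show "\<exists>S. open S \<and> 0 \<in> S \<and> (\<forall>t\<in>S. inv_into U \<phi> (\<phi> p + t *\<^sub>R w) \<in> V) \<and>
        smooth_on S (\<lambda>t. \<psi> (inv_into U \<phi> (\<phi> p + t *\<^sub>R w)))"
      by (intro exI[of _ S]) auto
  qed
qed

lemma velocity_line:
  assumes "(U, \<phi>) \<in> A" "p \<in> U"
  shows "velocity A (\<lambda>t. inv_into U \<phi> (\<phi> p + t *\<^sub>R w)) = chart_vec A (U, \<phi>) p w"
proof -
  have p: "inv_into U \<phi> (\<phi> p) = p" using assms chart_inj by simp
  obtain S where S: "open S" "(0::real) \<in> S" "\<And>t. t \<in> S \<Longrightarrow> \<phi> p + t *\<^sub>R w \<in> \<phi> ` (U \<inter> U)"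
    "\<And>t. t \<in> S \<Longrightarrow> inv_into U \<phi> (\<phi> p + t *\<^sub>R w) \<in> U \<inter> U"
    using line_preimage[OF assms(1) assms(1) assms(2) assms(2), of w] by meson
  have "((\<lambda>t. \<phi> p + t *\<^sub>R w) has_vector_derivative w) (at 0)"
    by (auto intro!: derivative_eq_intros)
  then have "((\<lambda>t. \<phi> (inv_into U \<phi> (\<phi> p + t *\<^sub>R w))) has_vector_derivative w) (at 0)"
    by (rule has_vector_derivative_transform_within_open[OF _ S(1,2)])
      (use S(3) in \<open>simp add: f_inv_into_f\<close>)
  then show ?thesis
    using velocity_eq_chart_vec[OF smooth_at_line[OF assms, of w] assms(1) chart_inj[OF assms(1)]]
      assms(2) p by (simp add: vector_derivative_at)
qed

text \<open>One inclusion is the chain rule for velocities, the other realises each coordinate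
  vector by a coordinate line. All later linear algebra in tangent spaces is carried out in the
  model space through this parametrisation.\<close>

lemma tangent_space_eq:
  assumes "(U, \<phi>) \<in> A" "p \<in> U"
  shows "tangent_space A p = range (chart_vec A (U, \<phi>) p)"
proof
  show "tangent_space A p \<subseteq> range (chart_vec A (U, \<phi>) p)"
    unfolding tangent_space_def
    using velocity_eq_chart_vec[OF _ assms(1) chart_inj[OF assms(1)]] assms(2) by auto
  show "range (chart_vec A (U, \<phi>) p) \<subseteq> tangent_space A p"
  proof clarify
    fix w
    have "inv_into U \<phi> (\<phi> p + 0 *\<^sub>R w) = p" using assms chart_inj by simp
    then show "chart_vec A (U, \<phi>) p w \<in> tangent_space A p"
      using velocity_line[OF assms, of w] smooth_at_line[OF assms, of w]
      unfolding tangent_space_def mem_Collect_eq by metis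
  qed
qed

text \<open>Tangent vectors are 0 by default on functions that are not smooth, so
  \<open>chart_coord\<close> gives the true components only once the coordinate functions are known
  to be smooth.\<close>

lemma smooth_at_component:
  assumes "(V, \<psi>) \<in> A" "p \<in> V"
  shows "smooth_at A euclid (\<lambda>q. \<psi> q \<bullet> b) p"
  unfolding smooth_at_real_iff
proof (intro conjI ballI; clarify?)
  show "p \<in> points A" using assms by (rule mem_points)
  fix U \<phi> assume U: "(U, \<phi>) \<in> A" "p \<in> U"
  show "\<exists>S. open S \<and> \<phi> p \<in> S \<and> S \<subseteq> \<phi> ` U \<and> smooth_on S (\<lambda>x. \<psi> (inv_into U \<phi> x) \<bullet> b)"
  proof (intro exI conjI)
    show "open (\<phi> ` (U \<inter> V))" by (rule overlap_open[OF U(1) assms(1)])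
    then show "smooth_on (\<phi> ` (U \<inter> V)) (\<lambda>x. \<psi> (inv_into U \<phi> x) \<bullet> b)"
      by (rule smooth_on_bounded_linear[OF _ bounded_linear_inner_left])
        (rule transition_smooth[OF U(1) assms(1)])
  qed (use assms U in auto)
qed

text \<open>The transformation law of vector components. It gives the fibre part of the transition
  maps of the slit bundle, and for equal charts it shows that \<open>chart_coord\<close> inverts
  \<open>chart_vec\<close>.\<close>

lemma chart_coord_transition:
  assumes "(U, \<phi>) \<in> A" "(V, \<psi>) \<in> A" "p \<in> U" "p \<in> V"
  shows "chart_coord \<psi> (chart_vec A (U, \<phi>) p w) =
    frechet_derivative (\<lambda>x. \<psi> (inv_into U \<phi> x)) (at (\<phi> p)) w" (is "_ = ?D w")
proof -
  have "chart_vec A (U, \<phi>) p w (\<lambda>q. \<psi> q \<bullet> b) = ?D w \<bullet> b" for b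
  proof -
    have "((\<lambda>x. \<psi> (inv_into U \<phi> x) \<bullet> b) has_derivative (\<lambda>h. ?D h \<bullet> b)) (at (\<phi> p))"
      using transition_differentiable[OF assms] unfolding frechet_derivative_works
      by (rule has_derivative_inner_left)
    then show ?thesis
      using smooth_at_component[OF assms(2,4)] by (simp add: chart_vec_def frechet_derivative_eqI)
  qed
  then show ?thesis by (simp add: chart_coord_def euclidean_representation)
qed

lemma chart_coord_chart_vec [simp]:
  assumes "(U, \<phi>) \<in> A" "p \<in> U"
  shows "chart_coord \<phi> (chart_vec A (U, \<phi>) p w) = w"
proof -
  have "((\<lambda>x. \<phi> (inv_into U \<phi> x)) has_derivative (\<lambda>h. h)) (at (\<phi> p))"
    by (rule has_derivative_transform_within_open[OF has_derivative_ident chart_open[OF assms(1)]])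
      (use assms in \<open>auto simp: f_inv_into_f\<close>)
  then show ?thesis
    using chart_coord_transition[OF assms(1) assms(1) assms(2) assms(2), of w]
    by (simp add: frechet_derivative_eqI)
qed

lemma chart_vec_linear:
  assumes "(U, \<phi>) \<in> A" "p \<in> U"
  shows "chart_vec A (U, \<phi>) p (a *\<^sub>R v + b *\<^sub>R w) =
    tadd (tscale a (chart_vec A (U, \<phi>) p v)) (tscale b (chart_vec A (U, \<phi>) p w))"
proof (rule ext)
  fix f
  show "chart_vec A (U, \<phi>) p (a *\<^sub>R v + b *\<^sub>R w) f =
    a * chart_vec A (U, \<phi>) p v f + b * chart_vec A (U, \<phi>) p w f"
    using linear_frechet_derivative[OF smooth_at_real_differentiable[OF _ assms], of f]
    by (auto simp: chart_vec_def linear_add linear_scale)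
qed

lemma chart_vec_eq_0_iff:
  assumes "(U, \<phi>) \<in> A" "p \<in> U"
  shows "chart_vec A (U, \<phi>) p w = tzero \<longleftrightarrow> w = 0"
proof
  assume "chart_vec A (U, \<phi>) p w = tzero"
  then have "chart_coord \<phi> (chart_vec A (U, \<phi>) p w) = 0" by (simp add: chart_coord_def)
  then show "w = 0" using assms by simp
next
  assume "w = 0"
  then show "chart_vec A (U, \<phi>) p w = tzero"
    using chart_vec_linear[OF assms, of 0 0 0 0] by simp
qed

section \<open>The slit bundle in charts and lifts of curves\<close>

lemma slit_dom_iff:
  assumes "(U, \<phi>) \<in> A"
  shows "u \<in> slit_dom A U \<longleftrightarrow> (\<exists>p\<in>U. \<exists>a. a \<noteq> 0 \<and> u = (p, chart_vec A (U, \<phi>) p a))"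
proof -
  have "(p, v) \<in> slit_dom A U \<longleftrightarrow> p \<in> U \<and> (\<exists>a. a \<noteq> 0 \<and> v = chart_vec A (U, \<phi>) p a)" for p v
    using assms mem_points chart_vec_eq_0_iff[OF assms] tangent_space_eq[OF assms]
    unfolding slit_dom_def slit_def by auto blast
  then show ?thesis by (cases u) auto
qed

lemma slit_cases:
  assumes "u \<in> slit A"
  obtains U \<phi> p a where "(U, \<phi>) \<in> A" "p \<in> U" "a \<noteq> 0" "u = (p, chart_vec A (U, \<phi>) p a)"
proof -
  from assms obtain U \<phi> where U: "(U, \<phi>) \<in> A" "u \<in> slit_dom A U"
    by (auto simp: points_slit_atlas[symmetric] points_def slit_atlas_eq)
  with that show thesis using slit_dom_iff by blast
qed

lemma slit_map_image:
  assumes "(U, \<phi>) \<in> A"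
  shows "slit_map \<phi> ` slit_dom A U = \<phi> ` U \<times> - {0 :: 'e}"
proof (intro equalityI subsetI)
  fix z assume "z \<in> slit_map \<phi> ` slit_dom A U"
  then show "z \<in> \<phi> ` U \<times> - {0 :: 'e}"
    using assms by (auto simp: slit_dom_iff slit_map_def)
next
  fix z assume "z \<in> \<phi> ` U \<times> - {0 :: 'e}"
  then obtain p a where "p \<in> U" "a \<noteq> 0" "z = (\<phi> p, a)" by auto
  then show "z \<in> slit_map \<phi> ` slit_dom A U"
    using assms by (intro image_eqI[of _ _ "(p, chart_vec A (U, \<phi>) p a)"])
      (auto simp: slit_dom_iff slit_map_def)
qed

lemma slit_map_inj:
  assumes "(U, \<phi>) \<in> A"
  shows "inj_on (slit_map \<phi>) (slit_dom A U)"
proof (rule inj_onI)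
  fix u u' assume "u \<in> slit_dom A U" "u' \<in> slit_dom A U" "slit_map \<phi> u = slit_map \<phi> u'"
  moreover from this obtain p a p' a' where "p \<in> U" "u = (p, chart_vec A (U, \<phi>) p a)"
      "p' \<in> U" "u' = (p', chart_vec A (U, \<phi>) p' a')"
    unfolding slit_dom_iff[OF assms] by blast
  ultimately show "u = u'"
    using assms inj_on_eq_iff[OF chart_inj[OF assms], of p p'] by (simp add: slit_map_def)
qed

lemma inv_into_slit_map:
  assumes "(U, \<phi>) \<in> A" "p \<in> U" "a \<noteq> 0"
  shows "inv_into (slit_dom A U) (slit_map \<phi>) (\<phi> p, a) = (p, chart_vec A (U, \<phi>) p a)"
  using assms by (intro inv_into_f_eq slit_map_inj) (auto simp: slit_dom_iff slit_map_def)

text \<open>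
  The lift of a coordinate line keeps the fibre coordinate \<open>a\<close> constant. In another chart its fibre
  coordinate is the derivative of the transition map in the fixed direction \<open>a\<close>.
\<close>

lemma smooth_at_lifted_line:
  assumes "(U, \<phi>) \<in> A" "p \<in> U" "a \<noteq> 0"
  shows "smooth_at euclid (slit_atlas A)
    (\<lambda>t. let q = inv_into U \<phi> (\<phi> p + t *\<^sub>R w) in (q, chart_vec A (U, \<phi>) q a)) 0"
    (is "smooth_at _ _ ?C 0")
proof -
  have p: "inv_into U \<phi> (\<phi> p) = p" using assms chart_inj by simp
  then have C0: "?C 0 = (p, chart_vec A (U, \<phi>) p a)" by simp
  show ?thesis unfolding smooth_at_curve_iff
  proof (intro conjI ballI)
    have "?C 0 \<in> slit_dom A U" using assms C0 by (auto simp: slit_dom_iff)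
    then show "?C 0 \<in> points (slit_atlas A)"
      using assms by (force simp: points_def slit_atlas_eq)
    fix W assume "W \<in> slit_atlas A"
    then obtain V \<psi> where V: "(V, \<psi>) \<in> A" "W = (slit_dom A V, slit_map \<psi>)"
      by (auto simp: slit_atlas_eq)
    have "\<exists>S. open S \<and> 0 \<in> S \<and> (\<forall>t\<in>S. ?C t \<in> slit_dom A V) \<and> smooth_on S (\<lambda>t. slit_map \<psi> (?C t))"
      if "?C 0 \<in> slit_dom A V"
    proof -
      from that C0 have "p \<in> V" by (simp add: slit_dom_def)
      then obtain S where S: "open S" "(0::real) \<in> S" "\<And>t. t \<in> S \<Longrightarrow> \<phi> p + t *\<^sub>R w \<in> \<phi> ` (U \<inter> V)"
        "\<And>t. t \<in> S \<Longrightarrow> inv_into U \<phi> (\<phi> p + t *\<^sub>R w) \<in> U \<inter> V"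
        using line_preimage[OF assms(1) V(1) assms(2), of w] by meson
      have dom: "?C t \<in> slit_dom A V" if "t \<in> S" for t
      proof -
        have "?C t \<in> slit_dom A U"
          using S(4)[OF that] assms(3) unfolding slit_dom_iff[OF assms(1)] Let_def by blast
        with S(4)[OF that] show ?thesis unfolding slit_dom_def Let_def by blast
      qed
      let ?\<tau> = "\<lambda>x. \<psi> (inv_into U \<phi> x)"
      have "smooth_on S (\<lambda>t. (?\<tau> (\<phi> p + t *\<^sub>R w),
          frechet_derivative ?\<tau> (at (\<phi> p + t *\<^sub>R w)) a))"
        by (intro smooth_on_Pair[OF S(1)]
            smooth_on_affine[OF S(1) bounded_linear_scaleR_left S(3) transition_smooth[OF assms(1) V(1)]]
            smooth_on_affine[OF S(1) bounded_linear_scaleR_left S(3)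
              smooth_on_frechet_derivative[OF transition_smooth[OF assms(1) V(1)]]])
      then have "smooth_on S (\<lambda>t. slit_map \<psi> (?C t))"
      proof (rule smooth_on_cong[OF S(1)])
        fix t assume t: "t \<in> S"
        have "\<phi> (inv_into U \<phi> (\<phi> p + t *\<^sub>R w)) = \<phi> p + t *\<^sub>R w"
          using S(3)[OF t] by (intro f_inv_into_f) auto
        then show "(?\<tau> (\<phi> p + t *\<^sub>R w), frechet_derivative ?\<tau> (at (\<phi> p + t *\<^sub>R w)) a) =
            slit_map \<psi> (?C t)"
          using S(4)[OF t] chart_coord_transition[OF assms(1) V(1)]
          by (simp add: slit_map_def Let_def)
      qed
      with S dom show ?thesis by blast
    qed
    then show "case W of (V, \<psi>) \<Rightarrow> ?C 0 \<in> V \<longrightarrow>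
        (\<exists>S. open S \<and> 0 \<in> S \<and> (\<forall>t\<in>S. ?C t \<in> V) \<and> smooth_on S (\<lambda>t. \<psi> (?C t)))"
      using V by simp
  qed
qed

text \<open>In a slit chart this function is the chart expression of \<open>f\<close> after the
  first projection. It is needed to evaluate \<open>rho\<close>, which tests a tangent vector of the
  slit bundle on such pullbacks.\<close>

lemma smooth_at_pullback:
  assumes "smooth_at A euclid f (fst u)" "u \<in> slit A"
  shows "smooth_at (slit_atlas A) euclid (\<lambda>z. f (fst z)) (u :: 'm tpoint)"
  unfolding smooth_at_real_iff
proof (intro conjI ballI)
  show "u \<in> points (slit_atlas A)" using assms by (simp add: points_slit_atlas)
  fix W assume "W \<in> slit_atlas A"
  then obtain U \<phi> where U: "(U, \<phi>) \<in> A" "W = (slit_dom A U, slit_map \<phi>)"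
    by (auto simp: slit_atlas_eq)
  have "\<exists>S. open S \<and> slit_map \<phi> u \<in> S \<and> S \<subseteq> slit_map \<phi> ` slit_dom A U \<and>
      smooth_on S (\<lambda>x. f (fst (inv_into (slit_dom A U) (slit_map \<phi>) x)))"
    if "u \<in> slit_dom A U"
  proof -
    from that obtain p a where u: "p \<in> U" "a \<noteq> 0" "u = (p, chart_vec A (U, \<phi>) p a)"
      using slit_dom_iff[OF U(1)] by blast
    with assms U obtain S where S: "open S" "\<phi> p \<in> S" "S \<subseteq> \<phi> ` U"
      "smooth_on S (\<lambda>x. f (inv_into U \<phi> x))"
      unfolding smooth_at_real_iff by fastforce
    \<comment> \<open>The chart image of the slit bundle contains only nonzero fibre
      coordinates.\<close>
    let ?S = "S \<times> - {0 :: 'e}"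
    have o: "open ?S" using S(1) by (intro open_Times) auto
    have "smooth_on ?S (\<lambda>z. f (inv_into U \<phi> (0 + fst z)))"
      by (rule smooth_on_affine[OF o bounded_linear_fst _ S(4)]) auto
    then have "smooth_on ?S (\<lambda>x. f (fst (inv_into (slit_dom A U) (slit_map \<phi>) x)))"
    proof (rule smooth_on_cong[OF o])
      fix z assume "z \<in> ?S"
      with S(3) obtain q b where "q \<in> U" "b \<noteq> 0" "z = (\<phi> q, b)" by (cases z) auto
      then show "f (inv_into U \<phi> (0 + fst z)) = f (fst (inv_into (slit_dom A U) (slit_map \<phi>) z))"
        using inv_into_slit_map[OF U(1)] chart_inj[OF U(1)] by simp
    qed
    moreover have "slit_map \<phi> u \<in> ?S" "?S \<subseteq> slit_map \<phi> ` slit_dom A U"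
      using S(2,3) u U(1) by (auto simp: slit_map_image[OF U(1)]) (simp_all add: slit_map_def)
    ultimately show ?thesis using o by (intro exI[of _ ?S] conjI)
  qed
  then show "case W of (U, \<phi>) \<Rightarrow> u \<in> U \<longrightarrow>
      (\<exists>S. open S \<and> \<phi> u \<in> S \<and> S \<subseteq> \<phi> ` U \<and> smooth_on S (\<lambda>x. f (fst (inv_into U \<phi> x))))"
    using U by simp
qed

text \<open>Represent \<open>v\<close> by a coordinate line in the base and lift it by freezing the
  fibre coordinate of \<open>u\<close>. The lift avoids the zero section because this coordinate is
  nonzero, and its velocity projects to \<open>v\<close>.\<close>

lemma rho_surj:
  assumes "u \<in> slit A" "v \<in> tangent_space A (fst u)"
  obtains \<xi> where "\<xi> \<in> tangent_space (slit_atlas A) u" "rho A u \<xi> = v"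
proof -
  from assms(1) obtain U \<phi> p a where
    u: "(U, \<phi>) \<in> A" "p \<in> U" "a \<noteq> 0" "u = (p, chart_vec A (U, \<phi>) p a)"
    by (rule slit_cases)
  with assms(2) obtain w where w: "v = chart_vec A (U, \<phi>) p w"
    using tangent_space_eq[OF u(1,2)] by auto
  define c where "c = (\<lambda>t. inv_into U \<phi> (\<phi> p + t *\<^sub>R w))"
  define C where "C = (\<lambda>t. (c t, chart_vec A (U, \<phi>) (c t) a))"
  have c0: "c 0 = p" using u chart_inj by (simp add: c_def)
  then have C0: "C 0 = u" by (simp add: C_def u)
  have "smooth_at euclid (slit_atlas A) C 0"
    using smooth_at_lifted_line[OF u(1-3), of w] by (simp add: C_def c_def Let_def)
  with C0 have 1: "velocity (slit_atlas A) C \<in> tangent_space (slit_atlas A) u"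
    unfolding tangent_space_def by blast
  \<comment> \<open>Both sides differentiate \<open>f\<close> along \<open>c\<close>; smoothness of
    the pullback ensures that the left side does not fall into the default case of
    \<open>velocity\<close> when \<open>f\<close> is smooth.\<close>
  have "rho A u (velocity (slit_atlas A) C) = velocity A c"
    using C0 c0 u assms(1)
    by (auto simp: rho_def differential_def velocity_def fun_eq_iff smooth_at_pullback)
      (simp add: C_def)
  with velocity_line[OF u(1,2), of w] w have "rho A u (velocity (slit_atlas A) C) = v"
    by (simp add: c_def)
  with 1 that show thesis by blast
qed

section \<open>Connections and the Finsler metric\<close>

lemma smooth_map_slit_const:
  "smooth_map (slit_atlas A) (euclid :: ('f, 'f::euclidean_space) atlas) (\<lambda>z. c)"
  unfolding smooth_map_def smooth_at_real_iff
proof (intro ballI conjI)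
  fix u W assume u: "u \<in> points (slit_atlas A)" and "W \<in> slit_atlas A"
  then obtain U \<phi> where U: "(U, \<phi>) \<in> A" "W = (slit_dom A U, slit_map \<phi>)"
    by (auto simp: slit_atlas_eq)
  have "open (slit_map \<phi> ` slit_dom A U)"
    unfolding slit_map_image[OF U(1)] by (intro open_Times chart_open[OF U(1)]) auto
  then show "case W of (U, \<phi>) \<Rightarrow> u \<in> U \<longrightarrow>
      (\<exists>S. open S \<and> \<phi> u \<in> S \<and> S \<subseteq> \<phi> ` U \<and> smooth_on S (\<lambda>x. c))"
    using U smooth_on_const by auto
qed

text \<open>
  The indicator function of the slit bundle counts as smooth, because smoothness only refers to
  points of the bundle; multiplying with it erases all other values of a section.
\<close>

lemma connection_local:
  assumes "linear_connection A D" "u \<in> slit A" "\<xi> \<in> tangent_space (slit_atlas A) u"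
    and "pi_vector_field A Y" "\<And>z. z \<in> slit A \<Longrightarrow> Y z = Y' z"
  shows "D u \<xi> Y = D u \<xi> Y'"
proof -
  let ?f = "indicator (slit A) :: 'm tpoint \<Rightarrow> real"
  have f: "smooth_map (slit_atlas A) euclid ?f"
    by (rule smooth_map_cong[OF smooth_map_slit_const[of 1]]) (simp add: points_slit_atlas)
  have Y': "pi_vector_field A Y'"
    using assms(4) unfolding pi_vector_field_def
    by (rule smooth_map_cong) (simp add: points_slit_atlas assms(5))
  have "\<xi> ?f = 0"
    using velocity_const[of "slit_atlas A" _ ?f 1] assms(3)
    by (auto simp: tangent_space_def points_slit_atlas)
  \<comment> \<open>By the Leibniz rule, since the indicator has value 1 and derivative 0 at
    \<open>u\<close>.\<close>
  then have loc: "D u \<xi> (\<lambda>z. tscale (?f z) (Z z)) = D u \<xi> Z" if "pi_vector_field A Z" for Z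
    using assms(1-3) f that unfolding linear_connection_def by simp
  have "D u \<xi> Y = D u \<xi> (\<lambda>z. tscale (?f z) (Y z))"
    by (rule loc[OF assms(4), symmetric])
  also have "(\<lambda>z. tscale (?f z) (Y z)) = (\<lambda>z. tscale (?f z) (Y' z))"
    using assms(5) by (auto simp: fun_eq_iff indicator_def)
  also have "D u \<xi> \<dots> = D u \<xi> Y'" by (rule loc[OF Y'])
  finally show ?thesis .
qed

lemma pi_vector_field_tangent:
  assumes "pi_vector_field A Y" "u \<in> slit A"
  shows "Y u \<in> tangent_space A (fst u)"
  using assms unfolding pi_vector_field_def smooth_map_def smooth_at_def points_slit_atlas
  by (auto simp: points_def tangent_atlas_def tangent_chart_def)

text \<open>\<open>beta\<close> picks a horizontal preimage, which must be shown to exist. Any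
  preimage under \<open>rho\<close> splits into a vertical and a horizontal part by regularity;
  \<open>rho\<close> kills the vertical part, so the horizontal part is again a preimage.\<close>

lemma beta:
  assumes "regular_connection A D" "u \<in> slit A" "v \<in> tangent_space A (fst u)"
  shows rho_beta: "rho A u (beta A D u v) = v"
    and beta_tangent: "beta A D u v \<in> tangent_space (slit_atlas A) u"
proof -
  obtain \<xi> where \<xi>: "\<xi> \<in> tangent_space (slit_atlas A) u" "rho A u \<xi> = v"
    using assms(2,3) by (rule rho_surj)
  with assms obtain a h where a: "\<xi> = tadd a h" "a \<in> vertical A u" and h: "h \<in> horizontal A D u"
    unfolding regular_connection_def by blast
  have "rho A u \<xi> = tadd (rho A u a) (rho A u h)"
    by (auto simp: a(1) rho_def differential_def)
  then have "v \<in> rho A u ` horizontal A D u"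
    using a(2) h \<xi>(2) by (auto simp: vertical_def)
  then show "rho A u (beta A D u v) = v" "beta A D u v \<in> tangent_space (slit_atlas A) u"
    unfolding beta_def using inv_into_into[of v "rho A u" "horizontal A D u"]
    by (simp_all add: f_inv_into_f horizontal_def)
qed

text \<open>In linear fibre coordinates the metric is the Hessian of half the square of the smooth
  function \<open>F\<close>, hence a symmetric form. Linearity in one argument suffices, as symmetry
  carries it to the other.\<close>

lemma finsler_metric_chart:
  assumes "finsler_structure A L" "(U, \<phi>) \<in> A" "p \<in> U" "a \<noteq> 0"
  obtains B where
    "\<And>v w. finsler_metric L (p, chart_vec A (U, \<phi>) p a)
       (chart_vec A (U, \<phi>) p v) (chart_vec A (U, \<phi>) p w) = B v w"
    "\<And>v w. B v w = B w v" "\<And>w. linear (\<lambda>v. B v w)"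
proof -
  let ?x = "chart_vec A (U, \<phi>) p" and ?I = "inv_into (slit_dom A U) (slit_map \<phi>)"
  define F where "F = (\<lambda>b. L (p, ?x b))"
  have u: "(p, ?x a) \<in> slit_dom A U" using assms(3,4) by (auto simp: slit_dom_iff[OF assms(2)])
  then have "smooth_at (slit_atlas A) euclid L (p, ?x a)"
    using assms(1) by (simp add: finsler_structure_def smooth_map_def points_slit_atlas slit_dom_def)
  with u assms(2) obtain S where S: "open S" "slit_map \<phi> (p, ?x a) \<in> S"
    "S \<subseteq> slit_map \<phi> ` slit_dom A U" "smooth_on S (\<lambda>z. L (?I z))"
    unfolding smooth_at_real_iff by (fastforce simp: slit_atlas_eq)
  let ?S = "Pair (\<phi> p) -` S"
  have o: "open ?S" using S(1) by (rule open_vimage) (intro continuous_intros)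
  have aS: "a \<in> ?S" using S(2) assms by (simp add: slit_map_def)
  \<comment> \<open>The fibre over \<open>p\<close> enters the slit chart by the affine map that
    sends \<open>b\<close> to \<open>(\<phi> p, b)\<close>.\<close>
  have "bounded_linear (\<lambda>b::'e. (0::'e, b))"
    by (intro bounded_linear_Pair bounded_linear_zero bounded_linear_ident)
  then have "smooth_on ?S (\<lambda>b. L (?I ((\<phi> p, 0) + (0, b))))"
    by (rule smooth_on_affine[OF o _ _ S(4)]) simp
  then have F: "smooth_on ?S F"
  proof (rule smooth_on_cong[OF o])
    fix b assume "b \<in> ?S"
    with S(3) have "b \<noteq> 0" unfolding slit_map_image[OF assms(2)] by auto
    then show "L (?I ((\<phi> p, 0) + (0, b))) = F b"
      using inv_into_slit_map[OF assms(2,3)] by (simp add: F_def)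
  qed
  define B where "B = (\<lambda>v w. frechet_derivative F (at a) v * frechet_derivative F (at a) w +
    F a * frechet_derivative (\<lambda>z. frechet_derivative F (at z) w) (at a) v)"
  show thesis
  proof
    fix v w
    \<comment> \<open>Fibre addition is addition of coordinates, which turns the definition of the
      metric into iterated derivatives of \<open>F\<close>.\<close>
    have "tadd (?x a) (tadd (tscale s (?x v)) (tscale t (?x w))) = ?x (a + s *\<^sub>R v + t *\<^sub>R w)" for s t
      using chart_vec_linear[OF assms(2,3), of 1 "a + s *\<^sub>R v" t w]
        chart_vec_linear[OF assms(2,3), of 1 a s v] by (simp add: add.assoc)
    then have "finsler_metric L (p, ?x a) (?x v) (?x w) =
        deriv (\<lambda>s. deriv (\<lambda>t. (F (a + s *\<^sub>R v + t *\<^sub>R w))\<^sup>2 / 2) 0) 0"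
      by (simp add: finsler_metric_def F_def)
    then show "finsler_metric L (p, ?x a) (?x v) (?x w) = B v w"
      using second_derivative_half_square[OF o aS F] by (simp add: B_def)
    show "B v w = B w v"
      using frechet_derivative_commute[OF o aS F, of v w] by (simp add: B_def mult.commute)
  next
    fix w
    have "linear (frechet_derivative F (at a))"
      "linear (frechet_derivative (\<lambda>z. frechet_derivative F (at z) w) (at a))"
      by (intro linear_frechet_derivative smooth_on_differentiable[OF _ aS]
          smooth_on_frechet_derivative F)+
    then show "linear (\<lambda>v. B v w)"
      unfolding B_def by (intro linearI) (simp_all add: linear_add linear_scale algebra_simps)
  qed
qed

lemma finsler_metric_props:
  assumes "finsler_structure A L" "u \<in> slit A" "v \<in> tangent_space A (fst u)"
    "w \<in> tangent_space A (fst u)"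
  shows finsler_metric_commute: "finsler_metric L u v w = finsler_metric L u w v"
    and finsler_metric_diff_right: "z \<in> tangent_space A (fst u) \<Longrightarrow>
      finsler_metric L u v (tdiff w z) = finsler_metric L u v w - finsler_metric L u v z"
proof -
  from assms(2) obtain U \<phi> p a where
    u: "(U, \<phi>) \<in> A" "p \<in> U" "a \<noteq> 0" "u = (p, chart_vec A (U, \<phi>) p a)"
    by (rule slit_cases)
  obtain B where B: "\<And>v w. finsler_metric L u
       (chart_vec A (U, \<phi>) p v) (chart_vec A (U, \<phi>) p w) = B v w"
    "\<And>v w. B v w = B w v" "\<And>w. linear (\<lambda>v. B v w)"
    using finsler_metric_chart[OF assms(1) u(1-3)] unfolding u(4) by blast
  have T: "tangent_space A (fst u) = range (chart_vec A (U, \<phi>) p)"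
    using tangent_space_eq[OF u(1,2)] u(4) by simp
  with assms(3,4) obtain v' w' where
    vw: "v = chart_vec A (U, \<phi>) p v'" "w = chart_vec A (U, \<phi>) p w'" by blast
  then show "finsler_metric L u v w = finsler_metric L u w v" using B by simp
  assume "z \<in> tangent_space A (fst u)"
  with T obtain z' where z: "z = chart_vec A (U, \<phi>) p z'" by blast
  have "tdiff w z = chart_vec A (U, \<phi>) p (w' - z')"
    using chart_vec_linear[OF u(1,2), of 1 w' "-1" z'] by (simp add: vw z)
  moreover have "B v' (w' - z') = B v' w' - B v' z'"
    using B(2) linear_diff[OF B(3)] by metis
  ultimately show "finsler_metric L u v (tdiff w z) = finsler_metric L u v w - finsler_metric L u v z"
    by (simp add: vw z B(1))
qed

text \<open>The exterior derivative equals the defect of self-adjointness for each pair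
  \<open>Y\<close>, \<open>Z\<close> at each point, so the theorem follows by quantifying over
  them.\<close>

lemma pi_exterior_derivative_metric:
  assumes L: "finsler_structure A L" and D: "cartan_connection A L D"
    and X: "pi_vector_field A X" and Y: "pi_vector_field A Y" and Z: "pi_vector_field A Z"
    and u: "u \<in> slit A"
  shows "pi_exterior_derivative A D (\<lambda>u w. finsler_metric L u (X u) w) Y Z u =
    finsler_metric L u (A_operator A D X Y u) (Z u) - finsler_metric L u (Y u) (A_operator A D X Z u)"
proof -
  note XT = pi_vector_field_tangent[OF X] and YT = pi_vector_field_tangent[OF Y]
    and ZT = pi_vector_field_tangent[OF Z]
  let ?bY = "\<lambda>z. beta A D z (Y z)" and ?bZ = "\<lambda>z. beta A D z (Z z)"
  from D have R: "regular_connection A D" and M: "metric_connection A L D"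
    and H: "h_torsion A D Y Z u = tzero"
    using Y Z u by (auto simp: cartan_connection_def)
  then have C: "linear_connection A D" by (simp add: regular_connection_def)
  have bY: "?bY u \<in> tangent_space (slit_atlas A) u" and bZ: "?bZ u \<in> tangent_space (slit_atlas A) u"
    using beta_tangent[OF R u] YT ZT u by auto
  have DT: "D u \<xi> V \<in> tangent_space A (fst u)"
    if "\<xi> \<in> tangent_space (slit_atlas A) u" "pi_vector_field A V" for \<xi> V
    using C u that unfolding linear_connection_def by blast
  \<comment> \<open>The torsion differentiates \<open>rho\<close> of the lift of \<open>Z\<close>,
    which is known to agree with \<open>Z\<close> only on the slit bundle; hence the appeal to
    locality.\<close>
  have "D u (?bY u) (\<lambda>z. rho A z (?bZ z)) = D u (?bY u) Z"
    by (rule connection_local[OF C u bY Z, symmetric]) (simp add: rho_beta[OF R] ZT)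
  moreover have "D u (?bZ u) (\<lambda>z. rho A z (?bY z)) = D u (?bZ u) Y"
    by (rule connection_local[OF C u bZ Y, symmetric]) (simp add: rho_beta[OF R] YT)
  \<comment> \<open>This is the vanishing of the horizontal torsion, solved for the bracket
    term.\<close>
  ultimately have br: "rho A u (lie_bracket (slit_atlas A) ?bY ?bZ u) =
      tdiff (D u (?bY u) Z) (D u (?bZ u) Y)"
    using H by (simp add: h_torsion_def torsion_def fun_eq_iff)
  have "?bY u (\<lambda>z. finsler_metric L z (X z) (Z z)) =
      finsler_metric L u (D u (?bY u) X) (Z u) + finsler_metric L u (X u) (D u (?bY u) Z)"
    using M u bY X Z unfolding metric_connection_def by (simp add: algebra_simps)
  moreover have "?bZ u (\<lambda>z. finsler_metric L z (X z) (Y z)) =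
      finsler_metric L u (D u (?bZ u) X) (Y u) + finsler_metric L u (X u) (D u (?bZ u) Y)"
    using M u bZ X Y unfolding metric_connection_def by (simp add: algebra_simps)
  moreover have "finsler_metric L u (X u) (tdiff (D u (?bY u) Z) (D u (?bZ u) Y)) =
      finsler_metric L u (X u) (D u (?bY u) Z) - finsler_metric L u (X u) (D u (?bZ u) Y)"
    by (intro finsler_metric_diff_right[OF L u] XT u DT bY bZ Y Z)
  moreover have "finsler_metric L u (D u (?bZ u) X) (Y u) = finsler_metric L u (Y u) (D u (?bZ u) X)"
    by (intro finsler_metric_commute[OF L u] YT u DT bZ X)
  ultimately show ?thesis
    by (simp add: pi_exterior_derivative_def A_operator_def br)
qed

end

theorem theorem2p6:
  fixes A :: "('m, 'e::euclidean_space) atlas"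
    and L :: "'m tpoint \<Rightarrow> real"
    and D :: "'m connection"
    and X :: "'m tpoint \<Rightarrow> 'm tvec"
  assumes "smooth_manifold A"
    and "finsler_structure A L"
    and "cartan_connection A L D"
    and "pi_vector_field A X"
  shows "d_closed_field A L D X \<longleftrightarrow> g_self_adjoint A L (A_operator A D X)"
proof -
  interpret manifold A using assms(1) by unfold_locales
  show ?thesis
    using pi_exterior_derivative_metric[OF assms(2-4)]
    unfolding d_closed_field_def d_closed_form_def g_self_adjoint_def by simp
qed

end
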